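(* For every perfect matching $M_0$ of $G^+$, the map $\Psi_{M_0}:M(G^+)\to K(G^+)$ is a bijection (and $\Psi_{M_0}(M_0)=0$).
   Context: $G$ is a finite connected planar graph (multi-edges allowed, no loops) with a fixed embedding in the plane, and $q$ is a fixed vertex of $G$ lying on the boundary of the infinite (outer) face. Let $G^\vee$ be the planar dual and $q^*$ the dual vertex of the outer face. Superimpose $G$ and $G^\vee$ so that each edge $e$ of $G$ crosses exactly its dual edge $e^*$, place a new vertex $w_e$ at each crossing, so each edge of $G$ and of $G^\vee$ is split into two half-edges; then delete $q$, $q^*$ and all half-edges incident to them. The resulting planar bipartite graph is $G^+$. Its white vertices are $W=\{w_e: e\in E(G)\}$; its black vertices are the vertices of $G$ other than $q$ and the bounded faces of $G$. Every edge of $G^+$ is a half-edge of an edge of $G$ or of $G^\vee$. $M(G^+)$ is the set of perfect matchings of $G^+$. For a spanning tree $T$ of $G$, the orientation $O_T$ of $G$ orients each edge of $T$ away from $q$ and each edge $e\notin T$ counterclockwise around the unique cycle in $T\cup\{e\}$. Given an orientation $O$ of $G$, the induced orientation $\widehat O$ of $G^+$ is: each half-edge of an edge $e$ of $G$ is oriented in the direction of $e$ in $O$; each half-edge of a dual edge $e^*$ is oriented in the direction of $e^*$, where $e^*$ is oriented as the $90^\circ$ counterclockwise rotation of the $O$-direction of $e$. An edge of $G^+$ is positively oriented if it points from its white endpoint to its black endpoint, negatively oriented otherwise. The Temperley matching $M_T$ consists of, for each $e\in T$, the positively oriented (in $\widehat{O_T}$) half-edge of $e$ at $w_e$, and for each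 $e\notin T$, the positively oriented half-edge of $e^*$ at $w_e$; $T\mapsto M_T$ is a bijection from spanning trees of $G$ to $M(G^+)$. Kasteleyn cokernel: for a $q$-connected orientation $O$ (e.g. $O_T$) and each black vertex $b$ let $r_b\in\mathbb Z^W$ have $w$-coordinate equal to (number of edges between $w$ and $b$ oriented $w\to b$ in $\widehat O$) minus (number oriented $b\to w$). $\mathrm{Prin}(G^+)$ is the subgroup of $\mathbb Z^W$ generated by the $r_b$, and $K(G^+)=\mathbb Z^W/\mathrm{Prin}(G^+)$. For a reference perfect matching $M_0=M_{T_0}$, use the orientation $\widehat{O_{T_0}}$. For $M\in M(G^+)$, $M_0\triangle M$ is a disjoint union of cycles; define $d\in\mathbb Z^W$ by $d(w)=1$ if $w$ lies on $M_0\triangle M$ and its two incident edges in $M_0\triangle M$ have opposite orientations (one positively, one negatively oriented), and $d(w)=0$ otherwise; $\Psi_{M_0}(M)=[d]\in K(G^+)$. *)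

theory Defs
  imports Main
begin

text \<open>A connected plane graph with a fixed embedding is encoded as a combinatorial map
  (rotation system) on a finite set of darts: every edge consists of two darts
  exchanged by the fixed-point free involution alp; sig sends a dart to the next dart
  counterclockwise around its tail vertex.  Vertices are sig-orbits, edges are
  alp-orbits, faces are orbits of alp o sig; a dart d has the face face_of d on its
  left.  Planarity of the embedding is Euler's formula V - E + F = 2.  The record
  also carries the chosen outer face and the chosen root vertex q.\<close>

record 'd emb =
  darts :: "'d set"
  alp :: "'d \<Rightarrow> 'd"
  sig :: "'d \<Rightarrow> 'd"
  outer :: "'d set"
  root :: "'d set"

definition orbit :: "('a \<Rightarrow> 'a) \<Rightarrow> 'a \<Rightarrow> 'a set" where
  "orbit f x = {(f ^^ n) x | n. True}"

definition vert_of :: "'d emb \<Rightarrow> 'd \<Rightarrow> 'd set" where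
  "vert_of G d = orbit (sig G) d"

definition edge_of :: "'d emb \<Rightarrow> 'd \<Rightarrow> 'd set" where
  "edge_of G d = {d, alp G d}"

definition face_of :: "'d emb \<Rightarrow> 'd \<Rightarrow> 'd set" where
  "face_of G d = orbit (alp G \<circ> sig G) d"

definition verts :: "'d emb \<Rightarrow> 'd set set" where
  "verts G = vert_of G ` darts G"

definition edges :: "'d emb \<Rightarrow> 'd set set" where
  "edges G = edge_of G ` darts G"

definition faces :: "'d emb \<Rightarrow> 'd set set" where
  "faces G = face_of G ` darts G"

definition plane_map :: "'d emb \<Rightarrow> bool" where
  "plane_map G \<longleftrightarrow>
     finite (darts G) \<and> darts G \<noteq> {} \<and>
     (\<forall>d\<in>darts G. alp G d \<in> darts G \<and> alp G d \<noteq> d \<and> alp G (alp G d) = d) \<and>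
     bij_betw (sig G) (darts G) (darts G) \<and>
     (\<forall>d\<in>darts G. \<forall>d'\<in>darts G.
        (d, d') \<in> {(x, y). x \<in> darts G \<and> (y = alp G x \<or> y = sig G x)}\<^sup>*) \<and>
     (\<forall>d\<in>darts G. alp G d \<notin> vert_of G d) \<and>
     int (card (verts G)) - int (card (edges G)) + int (card (faces G)) = 2"

text \<open>q lies on the boundary of the outer face.\<close>
definition plane_graph :: "'d emb \<Rightarrow> bool" where
  "plane_graph G \<longleftrightarrow> plane_map G \<and>
     (\<exists>d\<in>darts G. vert_of G d = root G \<and> face_of G d = outer G)"

subsection \<open>Spanning trees\<close>

definition tree_rel :: "'d emb \<Rightarrow> 'd set set \<Rightarrow> ('d set \<times> 'd set) set" where
  "tree_rel G T = {(vert_of G d, vert_of G (alp G d)) | d. d \<in> darts G \<and> edge_of G d \<in> T}"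

definition conn :: "'d emb \<Rightarrow> 'd set set \<Rightarrow> 'd set \<Rightarrow> 'd set \<Rightarrow> bool" where
  "conn G T u v \<longleftrightarrow> (u, v) \<in> (tree_rel G T)\<^sup>*"

text \<open>Spanning tree: spanning connected edge set without cycles (no edge of T has its
  endpoints connected in T minus that edge).\<close>
definition spanning_tree :: "'d emb \<Rightarrow> 'd set set \<Rightarrow> bool" where
  "spanning_tree G T \<longleftrightarrow> T \<subseteq> edges G \<and>
     (\<forall>u\<in>verts G. \<forall>v\<in>verts G. conn G T u v) \<and>
     (\<forall>d\<in>darts G. edge_of G d \<in> T \<longrightarrow>
        \<not> conn G (T - {edge_of G d}) (vert_of G d) (vert_of G (alp G d)))"

text \<open>Edges of the tree path between u and v.\<close>
definition tree_path_edges :: "'d emb \<Rightarrow> 'd set set \<Rightarrow> 'd set \<Rightarrow> 'd set \<Rightarrow> 'd set set" where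
  "tree_path_edges G T u v = {t \<in> T. \<not> conn G (T - {t}) u v}"

text \<open>Unique cycle in T plus the edge of d.\<close>
definition fund_cycle :: "'d emb \<Rightarrow> 'd set set \<Rightarrow> 'd \<Rightarrow> 'd set set" where
  "fund_cycle G T d = insert (edge_of G d) (tree_path_edges G T (vert_of G (alp G d)) (vert_of G d))"

text \<open>Adjacency of faces in the dual graph, using only dual edges of edges outside C.\<close>
definition dual_rel :: "'d emb \<Rightarrow> 'd set set \<Rightarrow> ('d set \<times> 'd set) set" where
  "dual_rel G C = {(face_of G d, face_of G (alp G d)) | d. d \<in> darts G \<and> edge_of G d \<notin> C}"

text \<open>The orientation O_T, as the set of darts giving the direction of each edge.
  A tree edge is oriented away from q; a non-tree edge d is oriented counterclockwise
  around its fundamental cycle, i.e. the face on the left of d lies in the bounded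
  region enclosed by the cycle (it is separated from the outer face).\<close>
definition tree_orient :: "'d emb \<Rightarrow> 'd set set \<Rightarrow> 'd set" where
  "tree_orient G T = {d \<in> darts G.
     if edge_of G d \<in> T then conn G (T - {edge_of G d}) (root G) (vert_of G d)
     else (face_of G d, outer G) \<notin> (dual_rel G (fund_cycle G T d))\<^sup>*}"

subsection \<open>The graph G+\<close>

datatype hk = Prim | Dual
datatype 'a blk = BV 'a | BF 'a

text \<open>Edge (d, Prim): primal half-edge between w_e and the tail of d;
  edge (d, Dual): dual half-edge between w_e and the face on the left of d.\<close>
definition plus_edges :: "'d emb \<Rightarrow> ('d \<times> hk) set" where
  "plus_edges G = {(d, Prim) | d. d \<in> darts G \<and> vert_of G d \<noteq> root G}
                \<union> {(d, Dual) | d. d \<in> darts G \<and> face_of G d \<noteq> outer G}"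

definition white_end :: "'d emb \<Rightarrow> 'd \<times> hk \<Rightarrow> 'd set" where
  "white_end G g = edge_of G (fst g)"

definition black_end :: "'d emb \<Rightarrow> 'd \<times> hk \<Rightarrow> 'd set blk" where
  "black_end G g = (case snd g of Prim \<Rightarrow> BV (vert_of G (fst g)) | Dual \<Rightarrow> BF (face_of G (fst g)))"

definition white_verts :: "'d emb \<Rightarrow> 'd set set" where
  "white_verts G = edges G"

definition black_verts :: "'d emb \<Rightarrow> 'd set blk set" where
  "black_verts G = BV ` (verts G - {root G}) \<union> BF ` (faces G - {outer G})"

definition perfect_matching :: "'d emb \<Rightarrow> ('d \<times> hk) set \<Rightarrow> bool" where
  "perfect_matching G M \<longleftrightarrow> M \<subseteq> plus_edges G \<and>
     (\<forall>w\<in>white_verts G. \<exists>!g. g \<in> M \<and> white_end G g = w) \<and>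
     (\<forall>b\<in>black_verts G. \<exists>!g. g \<in> M \<and> black_end G g = b)"

definition perfect_matchings :: "'d emb \<Rightarrow> ('d \<times> hk) set set" where
  "perfect_matchings G = {M. perfect_matching G M}"

text \<open>Positivity (pointing white to black) of an edge of G+ in the orientation induced
  by the orientation Or of G (Or = set of darts giving the edge directions; the dual
  edge is the 90 degree counterclockwise rotation, i.e. from right face to left face).\<close>
definition is_pos :: "'d set \<Rightarrow> 'd \<times> hk \<Rightarrow> bool" where
  "is_pos Or g = (case snd g of Prim \<Rightarrow> fst g \<notin> Or | Dual \<Rightarrow> fst g \<in> Or)"

text \<open>Temperley matching M_T.\<close>
definition temperley :: "'d emb \<Rightarrow> 'd set set \<Rightarrow> ('d \<times> hk) set" where
  "temperley G T = {g \<in> plus_edges G. is_pos (tree_orient G T) g \<and>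
      (if white_end G g \<in> T then snd g = Prim else snd g = Dual)}"

subsection \<open>Kasteleyn cokernel\<close>

definition kast_row :: "'d emb \<Rightarrow> 'd set \<Rightarrow> 'd set blk \<Rightarrow> 'd set \<Rightarrow> int" where
  "kast_row G Or b w = (\<Sum>g\<in>{g \<in> plus_edges G. white_end G g = w \<and> black_end G g = b}.
                          if is_pos Or g then 1 else -1)"

definition ZW :: "'d emb \<Rightarrow> ('d set \<Rightarrow> int) set" where
  "ZW G = {x. \<forall>w. w \<notin> white_verts G \<longrightarrow> x w = 0}"

definition Prin :: "'d emb \<Rightarrow> 'd set \<Rightarrow> ('d set \<Rightarrow> int) set" where
  "Prin G Or = {x. \<exists>c :: 'd set blk \<Rightarrow> int.
                  x = (\<lambda>w. \<Sum>b\<in>black_verts G. c b * kast_row G Or b w)}"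

definition krel :: "'d emb \<Rightarrow> 'd set \<Rightarrow> (('d set \<Rightarrow> int) \<times> ('d set \<Rightarrow> int)) set" where
  "krel G Or = {(x, y). x \<in> ZW G \<and> y \<in> ZW G \<and> (\<lambda>w. x w - y w) \<in> Prin G Or}"

definition kcoker :: "'d emb \<Rightarrow> 'd set \<Rightarrow> ('d set \<Rightarrow> int) set set" where
  "kcoker G Or = ZW G // krel G Or"

definition matched :: "'d emb \<Rightarrow> ('d \<times> hk) set \<Rightarrow> 'd set \<Rightarrow> 'd \<times> hk" where
  "matched G M w = (THE g. g \<in> M \<and> white_end G g = w)"

text \<open>The vector d of the definition of Psi: w lies on M0 symmetric-difference M iff its
  M0-edge and M-edge differ; these are then its two incident edges there.\<close>
definition psi_vec :: "'d emb \<Rightarrow> 'd set \<Rightarrow> ('d \<times> hk) set \<Rightarrow> ('d \<times> hk) set \<Rightarrow> 'd set \<Rightarrow> int" where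
  "psi_vec G Or M0 M w = (if w \<in> white_verts G \<and> matched G M0 w \<noteq> matched G M w \<and>
        is_pos Or (matched G M0 w) \<noteq> is_pos Or (matched G M w) then 1 else 0)"

text \<open>Psi_{M0} for M0 = M_{T0}, using the orientation induced by O_{T0}.\<close>
definition Psi :: "'d emb \<Rightarrow> 'd set set \<Rightarrow> ('d \<times> hk) set \<Rightarrow> ('d set \<Rightarrow> int) set" where
  "Psi G T0 M = krel G (tree_orient G T0) `` {psi_vec G (tree_orient G T0) (temperley G T0) M}"

end

theory Submission
  imports "HOL-Library.Indicator_Function" Defs
begin

text \<open>
  A perfect matching of G+ is a pair (P, Q) of dart sets: P holds the primal half-edges, one at each
  vertex other than q, and Q the dual half-edges, one in each bounded face. Declaring the edges of the
  matching positive defines an orientation O(P, Q), and Psi sends the matching to the class of the set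
  of edges on which O(P, Q) and the reference orientation differ. The cokernel is the quotient of the
  integer 1-chains by the coboundaries of vertex functions (cuts) and of face functions (cycles), which
  are orthogonal to each other.

  Trees: P and Q are arborescences rooted at q and at the outer face. Consider the corners whose vertex
  is reached by P and whose face is reached by Q. Walking around the tree P maps this finite set
  injectively, hence onto, itself; so at the vertices reached by P the boundary of the set of faces
  reached by Q is a circulation supported on P, and therefore zero. Together with the dual statement
  this shows that the set consists of all corners. The argument only needs that, at each of these
  corners, the edge in clockwise direction belongs to P or Q.

  Injectivity: if O(P', Q') - O(P, Q) is the coboundary of g plus that of h, then, by orthogonality, all
  edges of the cut around a maximal level set of g avoiding q leave that set in O(P, Q), so the set
  cannot be reached from q. Hence g, and dually h, is constant and the orientations agree. Then the
  corner argument applies to the intersections of P with P' and of Q with Q', so these are already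
  spanning and the matchings agree.

  Surjectivity: a chain of minimal distance to the orientations in its class is an orientation, since
  every edge lies on a directed cut or a directed cycle. Reversing directed cuts and cycles enlarges
  the sets of vertices and faces reachable from the roots until they are everything, and such an
  orientation is O(P, Q) for arborescences P and Q grown greedily at corners belonging to both.
\<close>

section \<open>Combinatorial maps\<close>

text \<open>A dart d is also a corner, namely the one at vert d between d and \<sigma> d, which lies in
  the face to the left of d; the base corner marks the root vertex and the outer face. Passing to the
  dual map exchanges vertices and faces, replaces \<sigma> by \<alpha> \<circ> \<sigma>, and fixes the corners.\<close>
locale combinatorial_map =
  fixes D :: "'d set" and \<alpha> \<sigma> :: "'d \<Rightarrow> 'd" and vert :: "'d \<Rightarrow> 'v" and face :: "'d \<Rightarrow> 'f"
    and d\<^sub>0 :: 'd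
  assumes finite_D: "finite D"
    and \<alpha>_in [simp]: "d \<in> D \<Longrightarrow> \<alpha> d \<in> D"
    and \<alpha>_neq [simp]: "d \<in> D \<Longrightarrow> \<alpha> d \<noteq> d"
    and \<alpha>_\<alpha> [simp]: "d \<in> D \<Longrightarrow> \<alpha> (\<alpha> d) = d"
    and bij_\<sigma>: "bij_betw \<sigma> D D"
    and vert_\<sigma>: "d \<in> D \<Longrightarrow> vert (\<sigma> d) = vert d"
    and face_\<alpha>_\<sigma>: "d \<in> D \<Longrightarrow> face (\<alpha> (\<sigma> d)) = face d"
    and connected: "\<lbrakk>X \<subseteq> D; X \<noteq> {}; \<And>d. d \<in> X \<Longrightarrow> \<alpha> d \<in> X; \<And>d. d \<in> X \<Longrightarrow> \<sigma> d \<in> X\<rbrakk> \<Longrightarrow> X = D"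
    and base_in [simp]: "d\<^sub>0 \<in> D"
begin

abbreviation V :: "'v set" where "V \<equiv> vert ` D"
abbreviation F :: "'f set" where "F \<equiv> face ` D"
abbreviation edge :: "'d \<Rightarrow> 'd set" where "edge d \<equiv> {d, \<alpha> d}"

lemma bij_\<alpha>: "bij_betw \<alpha> D D"
  by (rule bij_betw_byWitness[where f' = \<alpha>]) auto

lemma \<alpha>_eq_iff: "d \<in> D \<Longrightarrow> e \<in> D \<Longrightarrow> \<alpha> d = e \<longleftrightarrow> d = \<alpha> e"
  by auto

lemma mem_image_\<alpha>_iff: "P \<subseteq> D \<Longrightarrow> d \<in> D \<Longrightarrow> d \<in> \<alpha> ` P \<longleftrightarrow> \<alpha> d \<in> P"
  by (auto simp: image_iff) (metis \<alpha>_\<alpha>)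

lemma \<sigma>_in [simp]: "d \<in> D \<Longrightarrow> \<sigma> d \<in> D"
  using bij_\<sigma> by (auto simp: bij_betw_def)

lemma dual: "combinatorial_map D \<alpha> (\<alpha> \<circ> \<sigma>) face vert d\<^sub>0"
proof
  show "bij_betw (\<alpha> \<circ> \<sigma>) D D"
    using bij_betw_trans[OF bij_\<sigma> bij_\<alpha>] .
  show "X = D" if X: "X \<subseteq> D" "X \<noteq> {}" "\<And>d. d \<in> X \<Longrightarrow> \<alpha> d \<in> X" "\<And>d. d \<in> X \<Longrightarrow> (\<alpha> \<circ> \<sigma>) d \<in> X" for X
  proof (rule connected[OF X(1-3)])
    fix d assume "d \<in> X"
    then have "\<alpha> ((\<alpha> \<circ> \<sigma>) d) \<in> X" "d \<in> D" using X by blast+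
    then show "\<sigma> d \<in> X" by simp
  qed
qed (auto simp: finite_D vert_\<sigma> face_\<alpha>_\<sigma>)

definition \<sigma>_inv :: "'d \<Rightarrow> 'd" where
  "\<sigma>_inv = inv_into D \<sigma>"

lemma \<sigma>_inv_in [simp]: "d \<in> D \<Longrightarrow> \<sigma>_inv d \<in> D"
  and \<sigma>_\<sigma>_inv [simp]: "d \<in> D \<Longrightarrow> \<sigma> (\<sigma>_inv d) = d"
  and \<sigma>_inv_\<sigma> [simp]: "d \<in> D \<Longrightarrow> \<sigma>_inv (\<sigma> d) = d"
  using bij_\<sigma> by (auto simp: \<sigma>_inv_def bij_betw_def inv_into_into f_inv_into_f)

lemma vert_\<sigma>_inv [simp]: "d \<in> D \<Longrightarrow> vert (\<sigma>_inv d) = vert d"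
  using vert_\<sigma>[of "\<sigma>_inv d"] by simp

lemma face_\<sigma>_inv [simp]: "d \<in> D \<Longrightarrow> face (\<sigma>_inv d) = face (\<alpha> d)"
  using face_\<alpha>_\<sigma>[of "\<sigma>_inv d"] by simp

lemma V_subsetI:
  assumes "vert d\<^sub>0 \<in> R" and "\<And>d. d \<in> D \<Longrightarrow> vert d \<in> R \<Longrightarrow> vert (\<alpha> d) \<in> R"
  shows "V \<subseteq> R"
proof -
  have "{d \<in> D. vert d \<in> R} = D"
  proof (rule connected)
    show "{d \<in> D. vert d \<in> R} \<noteq> {}"
      using assms(1) base_in by blast
  qed (use assms(2) vert_\<sigma> in auto)
  then show ?thesis by auto
qed

subsection \<open>Reachability\<close>

text \<open>Darts are traversed from head to tail: the darts of a matching point from a vertex to its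
  parent, whereas reachability starts at the root.\<close>
definition steps :: "'d set \<Rightarrow> 'v rel" where
  "steps B = (\<lambda>d. (vert (\<alpha> d), vert d)) ` B"

definition reached :: "'d set \<Rightarrow> 'v set" where
  "reached B = (steps B)\<^sup>* `` {vert d\<^sub>0}"

lemma stepsI: "d \<in> B \<Longrightarrow> (vert (\<alpha> d), vert d) \<in> steps B"
  by (auto simp: steps_def)

lemma steps_mono: "B \<subseteq> C \<Longrightarrow> steps B \<subseteq> steps C"
  by (auto simp: steps_def)

lemma rtrancl_steps_mono: "B \<subseteq> C \<Longrightarrow> (u, v) \<in> (steps B)\<^sup>* \<Longrightarrow> (u, v) \<in> (steps C)\<^sup>*"
  using rtrancl_mono[OF steps_mono] by blast

lemma reached_base [simp]: "vert d\<^sub>0 \<in> reached B"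
  by (simp add: reached_def)

lemma reached_step: "d \<in> B \<Longrightarrow> vert (\<alpha> d) \<in> reached B \<Longrightarrow> vert d \<in> reached B"
  using stepsI by (auto simp: reached_def intro: rtrancl_into_rtrancl)

lemma reached_induct [consumes 1, case_names base step]:
  assumes "v \<in> reached B" and "Q (vert d\<^sub>0)"
    and "\<And>d. d \<in> B \<Longrightarrow> vert (\<alpha> d) \<in> reached B \<Longrightarrow> Q (vert (\<alpha> d)) \<Longrightarrow> Q (vert d)"
  shows "Q v"
proof -
  have "(vert d\<^sub>0, v) \<in> (steps B)\<^sup>*"
    using assms(1) by (simp add: reached_def)
  then show ?thesis
    by induction (use assms(2,3) in \<open>auto simp: reached_def steps_def\<close>)
qed

lemma reached_cases:
  assumes "v \<in> reached B"
  obtains "v = vert d\<^sub>0" | d where "d \<in> B" "v = vert d" "vert (\<alpha> d) \<in> reached B"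
  using assms by (induction rule: reached_induct) auto

lemma reached_subsetI:
  assumes "vert d\<^sub>0 \<in> A" and "\<And>d. d \<in> B \<Longrightarrow> vert (\<alpha> d) \<in> A \<Longrightarrow> vert d \<in> A"
  shows "reached B \<subseteq> A"
proof
  show "v \<in> A" if "v \<in> reached B" for v
    using that by (induction rule: reached_induct) (use assms in auto)
qed

lemma reached_mono: "B \<subseteq> C \<Longrightarrow> reached B \<subseteq> reached C"
  by (rule reached_subsetI) (auto intro: reached_step)

lemma reached_subset_V: "B \<subseteq> D \<Longrightarrow> reached B \<subseteq> V"
  by (rule reached_subsetI) auto

text \<open>A walk from the root that uses d has been at the head of d before.\<close>
lemma reached_remove_dart:
  assumes "v \<in> reached B"
  shows "v \<in> reached (B - {d}) \<or> vert (\<alpha> d) \<in> reached (B - {d})"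
  using assms by (induction rule: reached_induct) (auto intro: reached_step)

lemma steps_remove_edge:
  assumes "(u, v) \<in> (steps B)\<^sup>*" and "e \<in> D"
  defines "R \<equiv> (steps (B - edge e))\<^sup>*"
  shows "(u, v) \<in> R \<or> (u, vert e) \<in> R \<and> (vert (\<alpha> e), v) \<in> R \<or> (u, vert (\<alpha> e)) \<in> R \<and> (vert e, v) \<in> R"
  using assms(1)
proof induction
  case base
  then show ?case by (simp add: R_def)
next
  case (step y z)
  then obtain d where d: "d \<in> B" "y = vert (\<alpha> d)" "z = vert d"
    by (auto simp: steps_def)
  show ?case
  proof (cases "d \<in> edge e")
    case True
    then show ?thesis using step.IH d assms(2) by (auto simp: R_def)
  next
    case False
    then have "(y, z) \<in> steps (B - edge e)"
      using d by (auto intro: stepsI)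
    then show ?thesis
      using step.IH unfolding R_def by (meson rtrancl_into_rtrancl)
  qed
qed

definition edge_closed :: "'d set \<Rightarrow> bool" where
  "edge_closed B \<longleftrightarrow> B \<subseteq> D \<and> (\<forall>d\<in>B. \<alpha> d \<in> B)"

lemma edge_closedD: "edge_closed B \<Longrightarrow> B \<subseteq> D" "edge_closed B \<Longrightarrow> d \<in> D \<Longrightarrow> \<alpha> d \<in> B \<longleftrightarrow> d \<in> B"
  unfolding edge_closed_def by (blast, metis \<alpha>_\<alpha>)

lemma edge_closed_Diff: "edge_closed B \<Longrightarrow> edge_closed C \<Longrightarrow> edge_closed (B - C)"
  unfolding edge_closed_def by (metis Diff_iff \<alpha>_\<alpha> subset_iff)

lemma edge_closed_edge: "d \<in> D \<Longrightarrow> edge_closed (edge d)"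
  by (auto simp: edge_closed_def)

lemma edge_closed_Un_image: "P \<subseteq> D \<Longrightarrow> edge_closed (P \<union> \<alpha> ` P)"
  by (auto simp: edge_closed_def subset_iff)

lemma sym_steps: "edge_closed B \<Longrightarrow> sym (steps B)"
proof (rule symI)
  fix u v assume B: "edge_closed B" and "(u, v) \<in> steps B"
  then obtain d where "d \<in> B" "u = vert (\<alpha> d)" "v = vert d"
    by (auto simp: steps_def)
  then show "(v, u) \<in> steps B"
    using stepsI[of "\<alpha> d" B] B by (auto simp: edge_closed_def subset_iff)
qed

lemma rtrancl_steps_commute: "edge_closed B \<Longrightarrow> (u, v) \<in> (steps B)\<^sup>* \<longleftrightarrow> (v, u) \<in> (steps B)\<^sup>*"
  using sym_rtrancl[OF sym_steps] by (blast dest: symD)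

lemma reached_connected:
  assumes "edge_closed B" "u \<in> reached B" "v \<in> reached B"
  shows "(u, v) \<in> (steps B)\<^sup>*"
  using assms rtrancl_steps_commute by (metis Image_singleton_iff reached_def rtrancl_trans)

end

section \<open>Circulations\<close>

context combinatorial_map
begin

definition divergence :: "('d \<Rightarrow> 'a::ab_group_add) \<Rightarrow> 'v \<Rightarrow> 'a" where
  "divergence c v = (\<Sum>d\<in>{d \<in> D. vert d = v}. c d)"

definition antisymmetric :: "('d \<Rightarrow> 'a::ab_group_add) \<Rightarrow> bool" where
  "antisymmetric c \<longleftrightarrow> (\<forall>d\<in>D. c (\<alpha> d) = - c d)"

definition circulation :: "('d \<Rightarrow> 'a::ab_group_add) \<Rightarrow> bool" where
  "circulation c \<longleftrightarrow> antisymmetric c \<and> (\<forall>v. divergence c v = 0)"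

definition cob :: "('v \<Rightarrow> 'a::ab_group_add) \<Rightarrow> 'd \<Rightarrow> 'a" where
  "cob g d = g (vert (\<alpha> d)) - g (vert d)"

lemma cob_\<alpha>: "d \<in> D \<Longrightarrow> cob g (\<alpha> d) = - cob g d"
  by (simp add: cob_def)

lemma circulation_\<alpha>: "circulation c \<Longrightarrow> d \<in> D \<Longrightarrow> c (\<alpha> d) = - c d"
  by (simp add: circulation_def antisymmetric_def)

end

context combinatorial_map
begin

interpretation dual: combinatorial_map D \<alpha> "\<alpha> \<circ> \<sigma>" face vert d\<^sub>0
  by (rule dual)

lemma divergence_add: "divergence (\<lambda>d. b d + c d) v = divergence b v + divergence c v"
  by (simp add: divergence_def sum.distrib)

lemma divergence_diff: "divergence (\<lambda>d. b d - c d) v = divergence b v - divergence c v"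
  by (simp add: divergence_def sum_subtractf)

lemma circulation_diff: "circulation b \<Longrightarrow> circulation c \<Longrightarrow> circulation (\<lambda>d. b d - c d)"
  by (simp add: circulation_def antisymmetric_def divergence_diff)

lemma circulation_uminus: "circulation c \<Longrightarrow> circulation (\<lambda>d. - c d)"
  by (simp add: circulation_def antisymmetric_def divergence_def sum_negf)

lemma circulation_dual_cob: "circulation (dual.cob h)"
proof -
  have "divergence (dual.cob h) v = 0" for v
  proof -
    have "(\<Sum>d\<in>{d \<in> D. vert d = v}. h (face (\<alpha> d))) = (\<Sum>d\<in>{d \<in> D. vert d = v}. h (face d))"
      by (rule sum.reindex_bij_witness[of _ \<sigma> \<sigma>_inv]) (auto simp: vert_\<sigma>)
    then show ?thesis
      by (simp add: divergence_def dual.cob_def sum_subtractf)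
  qed
  then show ?thesis
    by (simp add: circulation_def antisymmetric_def dual.cob_\<alpha>)
qed

lemma circulation_orthogonal_cob:
  fixes c :: "'d \<Rightarrow> 'a::comm_ring"
  assumes "circulation c"
  shows "(\<Sum>d\<in>D. c d * cob g d) = 0"
proof -
  have "(\<Sum>d\<in>D. c d * g (vert d)) = (\<Sum>v\<in>V. divergence c v * g v)"
    unfolding divergence_def sum_distrib_right
    by (subst sum.image_gen[OF finite_D, where g = vert]) (auto intro!: sum.cong)
  also have "\<dots> = 0"
    using assms by (simp add: circulation_def)
  finally have tails: "(\<Sum>d\<in>D. c d * g (vert d)) = 0" .
  have "(\<Sum>d\<in>D. c d * g (vert (\<alpha> d))) = (\<Sum>d\<in>D. - (c d * g (vert d)))"
    by (rule sum.reindex_bij_witness[of _ \<alpha> \<alpha>])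
      (use circulation_\<alpha>[OF assms] in auto)
  with tails show ?thesis
    by (simp add: cob_def right_diff_distrib sum_subtractf sum_negf)
qed

lemma circulation_leaving_nonneg_eq_0:
  fixes z :: "'d \<Rightarrow> 'a::linordered_idom"
  assumes z: "circulation z"
    and nonneg: "\<And>d. d \<in> D \<Longrightarrow> vert d \<in> A \<Longrightarrow> vert (\<alpha> d) \<notin> A \<Longrightarrow> 0 \<le> z d"
    and d: "d \<in> D" "vert d \<in> A" "vert (\<alpha> d) \<notin> A"
  shows "z d = 0"
proof -
  let ?cut = "cob (\<lambda>v. - indicator A v)"
  have "0 \<le> z e * ?cut e" if "e \<in> D" for e
    using nonneg[of e] nonneg[of "\<alpha> e"] circulation_\<alpha>[OF z that] that
    by (cases "vert e \<in> A"; cases "vert (\<alpha> e) \<in> A") (simp_all add: cob_def)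
  moreover have "(\<Sum>e\<in>D. z e * ?cut e) = 0"
    by (rule circulation_orthogonal_cob[OF z])
  ultimately have "z d * ?cut d = 0"
    using sum_nonneg_eq_0_iff[OF finite_D, of "\<lambda>e. z e * ?cut e"] d(1) by simp
  then show ?thesis
    using d by (simp add: cob_def)
qed

subsection \<open>Flows along walks\<close>

lemma divergence_dart:
  fixes u :: 'v
  assumes "d \<in> D"
  shows "divergence (\<lambda>e. of_bool (e = d) - of_bool (e = \<alpha> d)) u =
    (of_bool (u = vert d) - of_bool (u = vert (\<alpha> d)) :: 'a::ring_1)"
proof -
  have "divergence (\<lambda>e. of_bool (e = x)) u = (of_bool (u = vert x) :: 'a)" if "x \<in> D" for x
    using that finite_D sum.delta[of "{d \<in> D. vert d = u}" x "\<lambda>_. 1 :: 'a"]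
    by (auto simp: divergence_def of_bool_def)
  then show ?thesis
    using assms by (simp add: divergence_diff)
qed

lemma antisymmetric_dart:
  "d \<in> D \<Longrightarrow> antisymmetric (\<lambda>e. of_bool (e = d) - of_bool (e = \<alpha> d) :: 'a::ring_1)"
  by (auto simp: antisymmetric_def \<alpha>_eq_iff)

lemma walk_flow:
  assumes "(u, v) \<in> (steps B)\<^sup>*" and B: "B \<subseteq> D"
  obtains y :: "'d \<Rightarrow> 'a::linordered_idom" where "antisymmetric y"
    "\<And>w. divergence y w = of_bool (w = v) - of_bool (w = u)"
    "\<And>e. e \<in> D \<Longrightarrow> \<alpha> e \<notin> B \<Longrightarrow> 0 \<le> y e"
proof -
  have "\<exists>y :: 'd \<Rightarrow> 'a. antisymmetric y \<and>
    (\<forall>w. divergence y w = of_bool (w = v) - of_bool (w = u)) \<and> (\<forall>e\<in>D. \<alpha> e \<notin> B \<longrightarrow> 0 \<le> y e)"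
    using assms(1)
  proof induction
    case base
    show ?case
      by (rule exI[of _ "\<lambda>_. 0"]) (simp add: antisymmetric_def divergence_def)
  next
    case (step x v)
    then obtain y :: "'d \<Rightarrow> 'a" where y: "antisymmetric y"
      "\<And>w. divergence y w = of_bool (w = x) - of_bool (w = u)" "\<forall>e\<in>D. \<alpha> e \<notin> B \<longrightarrow> 0 \<le> y e"
      by blast
    obtain d where d: "d \<in> B" "x = vert (\<alpha> d)" "v = vert d"
      using step(2) by (auto simp: steps_def)
    let ?y = "\<lambda>e. y e + (of_bool (e = d) - of_bool (e = \<alpha> d))"
    have dD: "d \<in> D" using d B by blast
    have "antisymmetric ?y"
      using y(1) antisymmetric_dart[OF dD, where 'a = 'a] by (simp add: antisymmetric_def)
    moreover have "divergence ?y w = of_bool (w = v) - of_bool (w = u)" for w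
      using d(2,3) y(2) divergence_dart[OF dD, of w, where 'a = 'a] by (simp add: divergence_add)
    moreover have "\<forall>e\<in>D. \<alpha> e \<notin> B \<longrightarrow> 0 \<le> ?y e"
      using y(3) d(1) dD by auto
    ultimately show ?case by blast
  qed
  then show ?thesis using that by blast
qed

lemma closed_walk_circulation:
  assumes walk: "(vert d, vert (\<alpha> d)) \<in> (steps B)\<^sup>*" and B: "B \<subseteq> D" and d: "d \<in> D" "\<alpha> d \<notin> B"
  obtains z :: "'d \<Rightarrow> 'a::linordered_idom" where "circulation z" "z d \<noteq> 0"
    "\<And>e. e \<in> D \<Longrightarrow> \<alpha> e \<notin> insert d B \<Longrightarrow> 0 \<le> z e"
proof -
  obtain y :: "'d \<Rightarrow> 'a" where y: "antisymmetric y"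
    "\<And>w. divergence y w = of_bool (w = vert (\<alpha> d)) - of_bool (w = vert d)"
    "\<And>e. e \<in> D \<Longrightarrow> \<alpha> e \<notin> B \<Longrightarrow> 0 \<le> y e"
    using walk_flow[OF walk B] by blast
  let ?z = "\<lambda>e. y e + (of_bool (e = d) - of_bool (e = \<alpha> d))"
  have "circulation ?z"
    using y(1,2) antisymmetric_dart[OF d(1), where 'a = 'a] divergence_dart[OF d(1), where 'a = 'a]
    by (simp add: circulation_def antisymmetric_def divergence_add)
  moreover have "?z d \<noteq> 0"
    using y(3)[OF d] \<alpha>_neq[OF d(1)] by auto
  moreover have "0 \<le> ?z e" if "e \<in> D" "\<alpha> e \<notin> insert d B" for e
    using y(3)[of e] that d(1) by auto
  ultimately show ?thesis by (rule that)
qed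

end

section \<open>Trees\<close>

context combinatorial_map
begin

definition parent_choice :: "'d set \<Rightarrow> bool" where
  "parent_choice P \<longleftrightarrow> P \<subseteq> D \<and> inj_on vert P \<and> vert d\<^sub>0 \<notin> vert ` P"

definition arborescence :: "'d set \<Rightarrow> bool" where
  "arborescence P \<longleftrightarrow> parent_choice P \<and> V \<subseteq> reached P"

definition edge_covered :: "'d set \<Rightarrow> 'd set \<Rightarrow> 'd \<Rightarrow> bool" where
  "edge_covered P Q d \<longleftrightarrow> d \<in> P \<or> \<alpha> d \<in> P \<or> d \<in> Q \<or> \<alpha> d \<in> Q"

lemma parent_choiceD:
  assumes "parent_choice P"
  shows "P \<subseteq> D" "inj_on vert P" "d \<in> P \<Longrightarrow> vert d \<noteq> vert d\<^sub>0"
  using assms by (auto simp: parent_choice_def image_iff)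

lemma parent_choice_subset: "parent_choice P \<Longrightarrow> P' \<subseteq> P \<Longrightarrow> parent_choice P'"
  unfolding parent_choice_def by (blast intro: inj_on_subset)

lemma arborescenceD:
  assumes "arborescence P"
  shows "parent_choice P" "P \<subseteq> D" "d \<in> D \<Longrightarrow> vert d \<in> reached P"
  using assms by (auto simp: arborescence_def parent_choice_def)

lemma parent_choice_reached_dart:
  assumes P: "parent_choice P" "P' \<subseteq> P" and d: "d \<in> P" "vert d \<in> reached P'"
  shows "d \<in> P'" "vert (\<alpha> d) \<in> reached P'"
proof -
  obtain e where e: "e \<in> P'" "vert d = vert e" "vert (\<alpha> e) \<in> reached P'"
    using d(2) parent_choiceD(3)[OF P(1) d(1)] by (auto elim: reached_cases)
  then have "d = e"
    using inj_onD[OF parent_choiceD(2)[OF P(1)]] P(2) d(1) by blast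
  then show "d \<in> P'" "vert (\<alpha> d) \<in> reached P'"
    using e by simp_all
qed

lemma reached_edge_iff:
  assumes P: "parent_choice P" and d: "d \<in> D" "d \<in> P \<or> \<alpha> d \<in> P"
  shows "vert (\<alpha> d) \<in> reached P \<longleftrightarrow> vert d \<in> reached P"
  using d parent_choice_reached_dart(2)[OF P order.refl] reached_step[of d P] reached_step[of "\<alpha> d" P]
  by fastforce

lemma arborescence_image:
  assumes "arborescence P"
  shows "vert ` P = V - {vert d\<^sub>0}"
proof
  show "vert ` P \<subseteq> V - {vert d\<^sub>0}"
    using parent_choiceD(1,3)[OF arborescenceD(1)[OF assms]] by auto
  show "V - {vert d\<^sub>0} \<subseteq> vert ` P"
    using arborescenceD(3)[OF assms] by (auto elim: reached_cases)
qed

lemma arborescence_remove_dart: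
  assumes P: "arborescence P" and d: "d \<in> P"
  shows "vert (\<alpha> d) \<in> reached (P - {d})" "vert d \<notin> reached (P - {d})"
proof -
  have "vert (\<alpha> d) \<in> reached P"
    using arborescenceD(2,3)[OF P] d by auto
  then show "vert (\<alpha> d) \<in> reached (P - {d})"
    using reached_remove_dart[of _ P d] by blast
  show "vert d \<notin> reached (P - {d})"
    using parent_choice_reached_dart(1)[OF arborescenceD(1)[OF P] _ d] by blast
qed

lemma arborescence_subset_eq:
  assumes "arborescence P" "arborescence P'" "P' \<subseteq> P"
  shows "P' = P"
  using assms parent_choice_reached_dart(1)[OF arborescenceD(1)] arborescenceD(2,3) by blast

lemma arborescence_antisym:
  assumes P: "arborescence P" and d: "d \<in> P"
  shows "\<alpha> d \<notin> P"
proof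
  assume "\<alpha> d \<in> P"
  have dD: "d \<in> D" using arborescenceD(2)[OF P] d by blast
  have "vert d \<in> reached (P - {d})"
    using parent_choice_reached_dart(2)[OF arborescenceD(1)[OF P] _ \<open>\<alpha> d \<in> P\<close> arborescence_remove_dart(1)[OF P d]] dD
    by auto
  then show False using arborescence_remove_dart(2)[OF P d] by simp
qed

lemma reached_insert_leaf:
  assumes P: "parent_choice P" "vert ` P \<subseteq> reached P"
    and d: "d \<in> D" "vert (\<alpha> d) \<in> reached P" "vert d \<notin> reached P"
  shows "parent_choice (insert d P)" "vert ` insert d P \<subseteq> reached (insert d P)"
proof -
  have mono: "reached P \<subseteq> reached (insert d P)"
    by (rule reached_mono) auto
  then have "vert d \<in> reached (insert d P)"
    using reached_step[of d "insert d P"] d(2) by auto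
  then show "vert ` insert d P \<subseteq> reached (insert d P)"
    using P(2) mono by auto
  have "vert d \<notin> vert ` P" "vert d \<noteq> vert d\<^sub>0"
    using d(3) P(2) by (blast, metis reached_base)
  then show "parent_choice (insert d P)"
    using P(1) d(1) by (auto simp: parent_choice_def)
qed

lemma arborescence_exists:
  assumes B: "B \<subseteq> D" "V \<subseteq> reached B"
  obtains P where "P \<subseteq> B" "arborescence P"
proof -
  define S where "S = {P. P \<subseteq> B \<and> parent_choice P \<and> vert ` P \<subseteq> reached P}"
  have "finite S"
    by (rule finite_subset[of _ "Pow D"]) (use B finite_D in \<open>auto simp: S_def\<close>)
  moreover have "{} \<in> S"
    by (simp add: S_def parent_choice_def)
  ultimately obtain P where "P \<in> S" and maximal: "\<forall>P'\<in>S. P \<subseteq> P' \<longrightarrow> P = P'"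
    using finite_has_maximal[of S] by auto
  then have P: "P \<subseteq> B" "parent_choice P" "vert ` P \<subseteq> reached P"
    by (auto simp: S_def)
  have "vert d \<in> reached P" if d: "d \<in> B" "vert (\<alpha> d) \<in> reached P" for d
  proof (rule ccontr)
    assume new: "vert d \<notin> reached P"
    then have "insert d P \<in> S"
      using reached_insert_leaf[OF P(2,3) _ d(2)] P(1) B(1) d(1) unfolding S_def by blast
    then have "d \<in> P" using maximal by blast
    then show False using P(3) new by blast
  qed
  then have "reached B \<subseteq> reached P"
    by (intro reached_subsetI reached_base)
  then show ?thesis
    using that P(1,2) B(2) by (auto simp: arborescence_def)
qed

inductive tree_sum :: "'d set \<Rightarrow> ('d \<Rightarrow> 'a::ab_group_add) \<Rightarrow> 'v \<Rightarrow> 'a \<Rightarrow> bool" for P z where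
  base: "tree_sum P z (vert d\<^sub>0) 0"
| step: "d \<in> P \<Longrightarrow> tree_sum P z (vert (\<alpha> d)) k \<Longrightarrow> tree_sum P z (vert d) (k + z d)"

lemma tree_sum_unique:
  assumes P: "parent_choice P" and "tree_sum P z v k" "tree_sum P z v k'"
  shows "k = k'"
  using assms(2,3)
proof (induction arbitrary: k' rule: tree_sum.induct)
  case base
  then show ?case
    by (cases rule: tree_sum.cases) (use parent_choiceD(3)[OF P] in auto)
next
  case (step d k)
  from step.prems show ?case
  proof (cases rule: tree_sum.cases)
    case base
    then show ?thesis using step.hyps(1) parent_choiceD(3)[OF P] by auto
  next
    case (step e j)
    then have "e = d"
      using \<open>d \<in> P\<close> inj_onD[OF parent_choiceD(2)[OF P]] by auto
    then show ?thesis using step step.IH by auto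
  qed
qed

lemma tree_potential:
  fixes z :: "'d \<Rightarrow> 'a::ab_group_add"
  assumes P: "parent_choice P"
  obtains g where "\<And>d. d \<in> P \<Longrightarrow> vert d \<in> reached P \<Longrightarrow> cob g d = z d"
    and "\<And>v. v \<notin> reached P \<Longrightarrow> g v = 0"
proof
  define g where "g v = (if v \<in> reached P then - (THE k. tree_sum P z v k) else 0)" for v
  show "g v = 0" if "v \<notin> reached P" for v
    using that by (simp add: g_def)
  have g: "g v = - k" if "v \<in> reached P" "tree_sum P z v k" for v k
  proof -
    have "(THE k. tree_sum P z v k) = k"
      using tree_sum_unique[OF P] that(2) by (intro the_equality)
    then show ?thesis using that(1) by (simp add: g_def)
  qed
  fix d assume d: "d \<in> P" "vert d \<in> reached P"
  have parent: "vert (\<alpha> d) \<in> reached P"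
    using parent_choice_reached_dart(2)[OF P order.refl d] .
  have "\<exists>k. tree_sum P z v k" if "v \<in> reached P" for v
    using that by (induction rule: reached_induct) (auto intro: tree_sum.intros)
  then obtain k where k: "tree_sum P z (vert (\<alpha> d)) k"
    using parent by blast
  then show "cob g d = z d"
    using g[OF parent k] g[OF d(2) tree_sum.step[OF d(1) k]] by (simp add: cob_def)
qed

text \<open>If c is the coboundary of g on the tree, then c is orthogonal to the coboundary of g, so the
  sum of the squares of c vanishes.\<close>
lemma circulation_on_tree_eq_0:
  fixes c :: "'d \<Rightarrow> 'a::linordered_idom"
  assumes P: "parent_choice P" and c: "circulation c"
    and supp: "\<And>d. \<lbrakk>d \<in> D; vert d \<in> reached P; d \<notin> P; \<alpha> d \<notin> P\<rbrakk> \<Longrightarrow> c d = 0"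
    and d: "d \<in> D" "vert d \<in> reached P"
  shows "c d = 0"
proof -
  obtain g where g: "\<And>d. d \<in> P \<Longrightarrow> vert d \<in> reached P \<Longrightarrow> cob g d = c d"
    and g_0: "\<And>v. v \<notin> reached P \<Longrightarrow> g v = 0"
    using tree_potential[OF P, of c] by blast
  have prod: "c e * cob g e = (if vert e \<in> reached P then c e * c e else 0)" if e: "e \<in> D" for e
  proof (cases "e \<in> P \<or> \<alpha> e \<in> P")
    case True
    then have "cob g e = (if vert e \<in> reached P then c e else 0)"
      using reached_edge_iff[OF P e] g[of e] g[of "\<alpha> e"] g_0 cob_\<alpha>[OF e, of g] circulation_\<alpha>[OF c e] e
      by (auto simp: cob_def)
    then show ?thesis by simp
  next
    case False
    then show ?thesis
      using supp[of e] supp[of "\<alpha> e"] circulation_\<alpha>[OF c e] g_0 e by (auto simp: cob_def)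
  qed
  have "(\<Sum>e\<in>D. c e * cob g e) = 0"
    by (rule circulation_orthogonal_cob[OF c])
  moreover have "0 \<le> c e * cob g e" if "e \<in> D" for e
    using prod[OF that] by simp
  ultimately have "c d * cob g d = 0"
    using sum_nonneg_eq_0_iff[OF finite_D, of "\<lambda>e. c e * cob g e"] d(1) by simp
  then show ?thesis
    using prod[OF d(1)] d(2) by simp
qed

end

section \<open>Pairs of trees covering their common corners\<close>

context combinatorial_map
begin

interpretation dual: combinatorial_map D \<alpha> "\<alpha> \<circ> \<sigma>" face vert d\<^sub>0
  by (rule dual)

definition corners_covered :: "'d set \<Rightarrow> 'd set \<Rightarrow> bool" where
  "corners_covered P Q \<longleftrightarrow>
    (\<forall>d\<in>D. vert d \<in> reached P \<longrightarrow> face d \<in> dual.reached Q \<longrightarrow> edge_covered P Q d)"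

text \<open>The clockwise walk around P: from a corner across the next edge or, if that edge belongs to P,
  along it.\<close>
definition next_corner :: "'d set \<Rightarrow> 'd \<Rightarrow> 'd" where
  "next_corner P d = \<sigma>_inv (if d \<in> P \<or> \<alpha> d \<in> P then \<alpha> d else d)"

lemma inj_on_next_corner: "inj_on (next_corner P) D"
proof (rule inj_onI)
  fix x y assume xy: "x \<in> D" "y \<in> D" "next_corner P x = next_corner P y"
  have "(if x \<in> P \<or> \<alpha> x \<in> P then \<alpha> x else x) = (if y \<in> P \<or> \<alpha> y \<in> P then \<alpha> y else y)"
    using arg_cong[OF xy(3), of \<sigma>] xy(1,2) by (simp add: next_corner_def split: if_splits)
  then show "x = y"
    using xy(1,2) by (auto split: if_splits) (metis \<alpha>_\<alpha>)+
qed

text \<open>The walk is injective on the finite set of corners reached by both trees, hence onto.\<close>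
lemma reached_corner_before_edge:
  assumes P: "parent_choice P" and Q: "dual.parent_choice Q" and cov: "corners_covered P Q"
    and d: "d \<in> D" "d \<notin> P" "\<alpha> d \<notin> P" "vert d \<in> reached P" "face (\<alpha> d) \<in> dual.reached Q"
  shows "face d \<in> dual.reached Q"
proof -
  define C where "C = {e \<in> D. vert e \<in> reached P \<and> face e \<in> dual.reached Q}"
  have C_D: "C \<subseteq> D" by (auto simp: C_def)
  have "next_corner P e \<in> C" if "e \<in> C" for e
  proof (cases "e \<in> P \<or> \<alpha> e \<in> P")
    case True
    then show ?thesis
      using that reached_edge_iff[OF P, of e] by (auto simp: C_def next_corner_def)
  next
    case False
    then have "e \<in> Q \<or> \<alpha> e \<in> Q"
      using that cov by (auto simp: C_def corners_covered_def edge_covered_def)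
    then show ?thesis
      using that False dual.reached_edge_iff[OF Q, of e] by (auto simp: C_def next_corner_def)
  qed
  then have onto: "next_corner P ` C = C"
    using finite_subset[OF C_D finite_D] inj_on_subset[OF inj_on_next_corner C_D] by (intro endo_inj_surj) auto
  have "next_corner P d \<in> C"
    using d by (simp add: C_def next_corner_def)
  then obtain e where e: "e \<in> C" "next_corner P d = next_corner P e"
    using onto by (metis imageE)
  then have "d = e"
    using inj_onD[OF inj_on_next_corner] d(1) C_D by blast
  then show ?thesis
    using e(1) by (simp add: C_def)
qed

lemma face_across_edge_reached_iff:
  assumes P: "parent_choice P" and Q: "dual.parent_choice Q" and cov: "corners_covered P Q"
    and d: "d \<in> D" "vert d \<in> reached P"
  shows "face (\<alpha> d) \<in> dual.reached Q \<longleftrightarrow> face d \<in> dual.reached Q"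
proof -
  let ?c = "dual.cob (indicator (dual.reached Q)) :: 'd \<Rightarrow> int"
  have "?c d = 0"
  proof (rule circulation_on_tree_eq_0[OF P circulation_dual_cob _ d])
    fix e assume e: "e \<in> D" "vert e \<in> reached P" "e \<notin> P" "\<alpha> e \<notin> P"
    have "face (\<alpha> e) \<in> dual.reached Q" if "face e \<in> dual.reached Q"
    proof -
      have "e \<in> Q \<or> \<alpha> e \<in> Q"
        using cov e that by (auto simp: corners_covered_def edge_covered_def)
      then show ?thesis
        using dual.reached_edge_iff[OF Q e(1)] that by simp
    qed
    then show "?c e = 0"
      using reached_corner_before_edge[OF P Q cov e(1,3,4,2)] by (auto simp: dual.cob_def indicator_def)
  qed
  then show ?thesis
    by (auto simp: dual.cob_def indicator_def split: if_splits)
qed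

end

context combinatorial_map
begin

interpretation dual: combinatorial_map D \<alpha> "\<alpha> \<circ> \<sigma>" face vert d\<^sub>0
  by (rule dual)

lemma corners_covered_dual: "dual.corners_covered Q P \<longleftrightarrow> corners_covered P Q"
  by (auto simp: corners_covered_def dual.corners_covered_def edge_covered_def)

theorem corners_covered_imp_arborescences:
  assumes P: "parent_choice P" and Q: "dual.parent_choice Q" and cov: "corners_covered P Q"
  shows "arborescence P" "dual.arborescence Q"
proof -
  let ?C = "{d \<in> D. vert d \<in> reached P \<and> face d \<in> dual.reached Q}"
  note face_iff = face_across_edge_reached_iff[OF P Q cov]
  note vert_iff = dual.face_across_edge_reached_iff[OF Q P cov[folded corners_covered_dual]]
  have "?C = D"
  proof (rule connected)
    have "d\<^sub>0 \<in> ?C" by simp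
    then show "?C \<noteq> {}" by blast
    show "\<alpha> d \<in> ?C" if "d \<in> ?C" for d
      using that face_iff vert_iff by simp
    show "\<sigma> d \<in> ?C" if "d \<in> ?C" for d
      using that face_iff[of "\<sigma> d"] by (simp add: vert_\<sigma> face_\<alpha>_\<sigma>)
  qed auto
  then show "arborescence P" "dual.arborescence Q"
    using P Q by (auto simp: arborescence_def dual.arborescence_def)
qed

end

section \<open>Planar maps\<close>

context combinatorial_map
begin

interpretation dual: combinatorial_map D \<alpha> "\<alpha> \<circ> \<sigma>" face vert d\<^sub>0
  by (rule dual)

definition edge_partition :: "'d set \<Rightarrow> 'd set \<Rightarrow> bool" where
  "edge_partition P Q \<longleftrightarrow>
    (\<forall>d\<in>D. of_bool (d \<in> P) + of_bool (\<alpha> d \<in> P) + of_bool (d \<in> Q) + of_bool (\<alpha> d \<in> Q) = (1::nat))"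

definition tree_pair :: "'d set \<Rightarrow> 'd set \<Rightarrow> bool" where
  "tree_pair P Q \<longleftrightarrow> arborescence P \<and> dual.arborescence Q \<and> edge_partition P Q"

lemma edge_partitionD:
  assumes "edge_partition P Q" "d \<in> D"
  shows "d \<in> P \<longleftrightarrow> \<alpha> d \<notin> P \<and> d \<notin> Q \<and> \<alpha> d \<notin> Q" "\<alpha> d \<in> P \<longleftrightarrow> d \<notin> P \<and> d \<notin> Q \<and> \<alpha> d \<notin> Q"
    "d \<in> Q \<longleftrightarrow> \<alpha> d \<notin> Q \<and> d \<notin> P \<and> \<alpha> d \<notin> P" "\<alpha> d \<in> Q \<longleftrightarrow> d \<notin> Q \<and> d \<notin> P \<and> \<alpha> d \<notin> P"
  using assms by (auto simp: edge_partition_def of_bool_def split: if_splits)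

lemma edge_partition_covered: "edge_partition P Q \<Longrightarrow> d \<in> D \<Longrightarrow> edge_covered P Q d"
  using edge_partitionD(1)[of P Q d] by (auto simp: edge_covered_def)

lemma V_subset_reached_D: "V \<subseteq> reached D"
  by (rule V_subsetI) (use reached_step[of "\<alpha> _" D] in auto)

text \<open>The boundary of the set of reached faces is a circulation supported on the tree.\<close>
lemma faces_reached_off_arborescence:
  assumes P: "arborescence P"
  shows "F \<subseteq> dual.reached (D - (P \<union> \<alpha> ` P))"
proof -
  define R where "R = dual.reached (D - (P \<union> \<alpha> ` P))"
  let ?c = "dual.cob (indicator R) :: 'd \<Rightarrow> int"
  have R_step: "face d \<in> R" if "d \<in> D" "d \<notin> P" "\<alpha> d \<notin> P" "face (\<alpha> d) \<in> R" for d
    using dual.reached_step[of d "D - (P \<union> \<alpha> ` P)"] that mem_image_\<alpha>_iff[OF arborescenceD(2)[OF P]]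
    by (simp add: R_def)
  have no_jump: "face (\<alpha> d) \<in> R \<longleftrightarrow> face d \<in> R" if d: "d \<in> D" for d
  proof -
    have "?c d = 0"
    proof (rule circulation_on_tree_eq_0[OF arborescenceD(1)[OF P] circulation_dual_cob])
      show "?c e = 0" if "e \<in> D" "e \<notin> P" "\<alpha> e \<notin> P" for e
        using R_step[of e] R_step[of "\<alpha> e"] that by (auto simp: dual.cob_def indicator_def)
    qed (use d arborescenceD(3)[OF P] in auto)
    then show ?thesis
      by (auto simp: dual.cob_def indicator_def split: if_splits)
  qed
  show ?thesis
    unfolding R_def[symmetric] by (rule dual.V_subsetI) (simp_all add: no_jump, simp add: R_def)
qed

lemma card_arborescence_edges:
  assumes P: "arborescence P"
  shows "card (P \<union> \<alpha> ` P) + 2 = 2 * card V"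
proof -
  have fin: "finite P"
    using arborescenceD(2)[OF P] finite_D finite_subset by blast
  have "card P = card V - 1"
    using card_image[OF parent_choiceD(2)[OF arborescenceD(1)[OF P]]] arborescence_image[OF P] finite_D by simp
  moreover have "card V \<ge> 1"
    using finite_D base_in by (metis One_nat_def Suc_leI card_gt_0_iff empty_iff finite_imageI image_is_empty)
  moreover have "card (\<alpha> ` P) = card P"
    using bij_\<alpha> arborescenceD(2)[OF P] by (intro card_image) (auto simp: bij_betw_def intro: inj_on_subset)
  moreover have "P \<inter> \<alpha> ` P = {}"
    using arborescence_antisym[OF P] by blast
  ultimately show ?thesis
    using fin by (simp add: card_Un_disjoint)
qed

end

locale planar_map = combinatorial_map D \<alpha> \<sigma> vert face d\<^sub>0
  for D :: "'d set" and \<alpha> \<sigma> :: "'d \<Rightarrow> 'd" and vert :: "'d \<Rightarrow> 'v" and face :: "'d \<Rightarrow> 'f" and d\<^sub>0 :: 'd +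
  assumes euler: "2 * card V + 2 * card F = card D + 4"

context planar_map
begin

lemma dual_planar: "planar_map D \<alpha> (\<alpha> \<circ> \<sigma>) face vert d\<^sub>0"
  using dual euler by (simp add: planar_map_def planar_map_axioms_def)

interpretation dual: planar_map D \<alpha> "\<alpha> \<circ> \<sigma>" face vert d\<^sub>0
  by (rule dual_planar)

lemma complementary_arborescence:
  assumes P: "arborescence P"
  obtains Q where "tree_pair P Q" "Q \<union> \<alpha> ` Q = D - (P \<union> \<alpha> ` P)"
proof -
  define T where "T = P \<union> \<alpha> ` P"
  have T: "T \<subseteq> D" "\<And>d. d \<in> D \<Longrightarrow> \<alpha> d \<in> T \<longleftrightarrow> d \<in> T"
    using edge_closedD[OF edge_closed_Un_image[OF arborescenceD(2)[OF P]]] by (auto simp: T_def)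
  obtain Q where Q: "Q \<subseteq> D - T" "dual.arborescence Q"
    using dual.arborescence_exists[of "D - T"] faces_reached_off_arborescence[OF P] by (auto simp: T_def)
  have Q_D: "Q \<subseteq> D" using Q(1) by blast
  have "card (Q \<union> \<alpha> ` Q) = card (D - T)"
    using card_arborescence_edges[OF P] dual.card_arborescence_edges[OF Q(2)] euler
      card_Diff_subset[OF finite_subset[OF T(1) finite_D] T(1)] by (simp add: T_def)
  moreover have "Q \<union> \<alpha> ` Q \<subseteq> D - T"
    using Q(1) T(2) by auto
  ultimately have co: "Q \<union> \<alpha> ` Q = D - T"
    using finite_D by (intro card_subset_eq) auto
  have "edge_partition P Q"
    unfolding edge_partition_def
  proof
    fix d assume d: "d \<in> D"
    have "d \<in> P \<or> \<alpha> d \<in> P \<longleftrightarrow> d \<in> T" "d \<in> Q \<or> \<alpha> d \<in> Q \<longleftrightarrow> d \<in> D - T"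
      using co mem_image_\<alpha>_iff[OF Q_D d] mem_image_\<alpha>_iff[OF arborescenceD(2)[OF P] d] by (auto simp: T_def)
    then show "of_bool (d \<in> P) + of_bool (\<alpha> d \<in> P) + of_bool (d \<in> Q) + of_bool (\<alpha> d \<in> Q) = (1::nat)"
      using arborescence_antisym[OF P, of d] dual.arborescence_antisym[OF Q(2), of d] d by auto
  qed
  then show ?thesis
    using that P Q(2) co by (simp add: tree_pair_def T_def)
qed

lemma circulation_is_dual_cob:
  fixes z :: "'d \<Rightarrow> 'a::linordered_idom"
  assumes z: "circulation z"
  obtains h where "\<And>d. d \<in> D \<Longrightarrow> z d = dual.cob h d"
proof -
  obtain P Q where P: "arborescence P" and Q: "dual.arborescence Q" and part: "edge_partition P Q"
    using arborescence_exists[OF order.refl V_subset_reached_D] complementary_arborescence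
    unfolding tree_pair_def by metis
  obtain h where h: "\<And>d. d \<in> Q \<Longrightarrow> dual.cob h d = z d"
    using dual.tree_potential[OF dual.arborescenceD(1)[OF Q], of z] dual.arborescenceD(2,3)[OF Q]
    by (metis subsetD)
  have diff: "circulation (\<lambda>d. z d - dual.cob h d)"
    by (rule circulation_diff[OF z circulation_dual_cob])
  have "z d - dual.cob h d = 0" if d: "d \<in> D" for d
  proof (rule circulation_on_tree_eq_0[OF arborescenceD(1)[OF P] diff])
    fix e assume e: "e \<in> D" "e \<notin> P" "\<alpha> e \<notin> P"
    then have "e \<in> Q \<or> \<alpha> e \<in> Q"
      using edge_partition_covered[OF part e(1)] by (simp add: edge_covered_def)
    then show "z e - dual.cob h e = 0"
      using h circulation_\<alpha>[OF diff e(1)] by auto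
  qed (use d arborescenceD(3)[OF P] in auto)
  then show ?thesis using that by auto
qed

lemma closed_walk_separates:
  assumes B: "edge_closed B" and d: "d \<in> D" "d \<notin> B" and walk: "(vert d, vert (\<alpha> d)) \<in> (steps B)\<^sup>*"
  shows "\<not> (face d \<in> dual.reached (D - B - edge d) \<and> face (\<alpha> d) \<in> dual.reached (D - B - edge d))"
proof
  let ?C = "D - B - edge d"
  assume reached: "face d \<in> dual.reached ?C \<and> face (\<alpha> d) \<in> dual.reached ?C"
  note B_D = edge_closedD(1)[OF B] and B_iff = edge_closedD(2)[OF B]
  obtain z :: "'d \<Rightarrow> int" where z: "circulation z" "z d \<noteq> 0"
    and nonneg: "\<And>e. e \<in> D \<Longrightarrow> \<alpha> e \<notin> insert d B \<Longrightarrow> 0 \<le> z e"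
    using closed_walk_circulation[OF walk B_D d(1)] d B_iff by blast
  obtain h where h: "\<And>e. e \<in> D \<Longrightarrow> z e = dual.cob h e"
    using circulation_is_dual_cob[OF z(1)] by blast
  have off: "z e = 0" if "e \<in> ?C" for e
    using nonneg[of e] nonneg[of "\<alpha> e"] circulation_\<alpha>[OF z(1), of e] that B_iff d(1) \<alpha>_eq_iff[of e d]
    by auto
  have "h f = h (face d\<^sub>0)" if "f \<in> dual.reached ?C" for f
    using that
  proof (induction rule: dual.reached_induct)
    case (step e)
    then show ?case
      using off[of e] h[of e] by (simp add: dual.cob_def)
  qed simp
  then have "z d = 0"
    using reached h[OF d(1)] by (metis diff_self dual.cob_def)
  then show False using z(2) by simp
qed

end

section \<open>Orientations and equivalence of chains\<close>

context combinatorial_map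
begin

interpretation dual: combinatorial_map D \<alpha> "\<alpha> \<circ> \<sigma>" face vert d\<^sub>0
  by (rule dual)

definition orientation :: "'d set \<Rightarrow> bool" where
  "orientation U \<longleftrightarrow> U \<subseteq> D \<and> (\<forall>d\<in>D. \<alpha> d \<in> U \<longleftrightarrow> d \<notin> U)"

definition quasi_orientation :: "('d \<Rightarrow> int) \<Rightarrow> bool" where
  "quasi_orientation u \<longleftrightarrow> (\<forall>d\<in>D. u d + u (\<alpha> d) = 1)"

definition equivalent :: "('d \<Rightarrow> int) \<Rightarrow> ('d \<Rightarrow> int) \<Rightarrow> bool" where
  "equivalent x y \<longleftrightarrow> (\<exists>g h. \<forall>d\<in>D. y d - x d = cob g d + dual.cob h d)"

definition matching_orientation :: "'d set \<Rightarrow> 'd set \<Rightarrow> 'd set" where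
  "matching_orientation P Q = \<alpha> ` P \<union> Q"

lemma orientationD:
  assumes "orientation U"
  shows "U \<subseteq> D" "d \<in> D \<Longrightarrow> \<alpha> d \<in> U \<longleftrightarrow> d \<notin> U"
  using assms by (auto simp: orientation_def)

lemma orientation_complement: "orientation U \<Longrightarrow> orientation (D - U)"
  by (auto simp: orientation_def)

lemma quasi_orientationD: "quasi_orientation u \<Longrightarrow> d \<in> D \<Longrightarrow> u (\<alpha> d) = 1 - u d"
  by (simp add: quasi_orientation_def algebra_simps)

lemma quasi_orientation_complement: "quasi_orientation u \<Longrightarrow> quasi_orientation (\<lambda>d. 1 - u d)"
  by (fastforce simp: quasi_orientation_def)

lemma orientation_positive: "quasi_orientation u \<Longrightarrow> orientation {d \<in> D. 1 \<le> u d}"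
  using quasi_orientationD by (fastforce simp: orientation_def)

lemma equivalentI:
  "(\<And>d. d \<in> D \<Longrightarrow> y d - x d = cob g d + dual.cob h d) \<Longrightarrow> equivalent x y"
  unfolding equivalent_def by blast

lemma equivalent_cong:
  "(\<And>d. d \<in> D \<Longrightarrow> x d = x' d) \<Longrightarrow> (\<And>d. d \<in> D \<Longrightarrow> y d = y' d) \<Longrightarrow> equivalent x y \<longleftrightarrow> equivalent x' y'"
  by (simp add: equivalent_def)

lemma equivalent_add_cob: "equivalent x (\<lambda>d. x d + cob g d)"
  by (rule equivalentI[of _ _ g "\<lambda>_. 0"]) (simp add: dual.cob_def)

lemma equivalent_refl: "equivalent x x"
  using equivalent_add_cob[of x "\<lambda>_. 0"] by (simp add: cob_def)

lemma equivalent_complement: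
  assumes "equivalent x y"
  shows "equivalent (\<lambda>d. 1 - x d) (\<lambda>d. 1 - y d)"
proof -
  obtain g h where gh: "\<And>d. d \<in> D \<Longrightarrow> y d - x d = cob g d + dual.cob h d"
    using assms unfolding equivalent_def by blast
  show ?thesis
    by (rule equivalentI[of _ _ "\<lambda>v. - g v" "\<lambda>f. - h f"])
      (use gh in \<open>simp add: cob_def dual.cob_def algebra_simps\<close>)
qed

lemma equivalent_sym:
  assumes "equivalent x y"
  shows "equivalent y x"
proof -
  obtain g h where gh: "\<And>d. d \<in> D \<Longrightarrow> y d - x d = cob g d + dual.cob h d"
    using assms unfolding equivalent_def by blast
  show ?thesis
    by (rule equivalentI[of _ _ "\<lambda>v. - g v" "\<lambda>f. - h f"])
      (use gh in \<open>simp add: cob_def dual.cob_def algebra_simps\<close>)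
qed

lemma equivalent_trans [trans]:
  assumes "equivalent x y" "equivalent y z"
  shows "equivalent x z"
proof -
  obtain g h where gh: "\<And>d. d \<in> D \<Longrightarrow> y d - x d = cob g d + dual.cob h d"
    using assms(1) unfolding equivalent_def by blast
  obtain g' h' where gh': "\<And>d. d \<in> D \<Longrightarrow> z d - y d = cob g' d + dual.cob h' d"
    using assms(2) unfolding equivalent_def by blast
  have "z d - x d = cob (\<lambda>v. g v + g' v) d + dual.cob (\<lambda>f. h f + h' f) d" if "d \<in> D" for d
    using gh[OF that] gh'[OF that] by (simp add: cob_def dual.cob_def)
  then show ?thesis by (rule equivalentI)
qed

lemma quasi_orientation_equivalent:
  assumes "quasi_orientation x" "equivalent x y"
  shows "quasi_orientation y"
proof -
  obtain g h where gh: "\<And>d. d \<in> D \<Longrightarrow> y d - x d = cob g d + dual.cob h d"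
    using assms(2) unfolding equivalent_def by blast
  have "y d + y (\<alpha> d) = 1" if "d \<in> D" for d
    using quasi_orientationD[OF assms(1) that] gh[OF that] gh[OF \<alpha>_in[OF that]] that
    by (simp add: cob_def dual.cob_def algebra_simps)
  then show ?thesis by (simp add: quasi_orientation_def)
qed

lemma mem_matching_orientation_iff:
  assumes "tree_pair P Q" "d \<in> D"
  shows "d \<in> matching_orientation P Q \<longleftrightarrow> \<alpha> d \<in> P \<or> d \<in> Q"
    and "d \<notin> matching_orientation P Q \<longleftrightarrow> d \<in> P \<or> \<alpha> d \<in> Q"
proof -
  show "d \<in> matching_orientation P Q \<longleftrightarrow> \<alpha> d \<in> P \<or> d \<in> Q"
    using assms mem_image_\<alpha>_iff[OF arborescenceD(2)]
    by (simp add: matching_orientation_def tree_pair_def)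
  then show "d \<notin> matching_orientation P Q \<longleftrightarrow> d \<in> P \<or> \<alpha> d \<in> Q"
    using edge_partitionD[of P Q d] assms unfolding tree_pair_def by blast
qed

lemma matching_orientation_subset: "tree_pair P Q \<Longrightarrow> matching_orientation P Q \<subseteq> D"
  using arborescenceD(2) dual.arborescenceD(2) by (fastforce simp: matching_orientation_def tree_pair_def)

lemma orientation_matching_orientation:
  assumes "tree_pair P Q"
  shows "orientation (matching_orientation P Q)"
  using matching_orientation_subset[OF assms] mem_matching_orientation_iff[OF assms]
  by (simp add: orientation_def)

text \<open>On the edges of the cut around a maximal level set of g the coboundary of h vanishes and g drops,
  so these edges all leave the level set in the orientation of (P, Q), in which every vertex can be
  reached from the root.\<close>
lemma potential_le_root:
  assumes PQ: "tree_pair P Q"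
    and gh: "\<And>d. d \<in> D \<Longrightarrow> indicator U d - indicator (matching_orientation P Q) d = cob g d + dual.cob h d"
    and v: "v \<in> V"
  shows "g v \<le> (g (vert d\<^sub>0) :: int)"
proof (rule ccontr)
  assume above: "\<not> ?thesis"
  define m where "m = Max (g ` V)"
  define A where "A = {u \<in> V. g u = m}"
  have finite_levels: "finite (g ` V)" using finite_D by simp
  have le_m: "g u \<le> m" if "u \<in> V" for u
    using that finite_levels by (simp add: m_def)
  have root: "vert d\<^sub>0 \<notin> A"
    using le_m[OF v] above by (auto simp: A_def)
  have drop: "cob g d \<le> -1" if "d \<in> D" "vert d \<in> A" "vert (\<alpha> d) \<notin> A" for d
    using that le_m[of "vert (\<alpha> d)"] by (auto simp: A_def cob_def)
  have leaves: "d \<in> matching_orientation P Q" if d: "d \<in> D" "vert d \<in> A" "vert (\<alpha> d) \<notin> A" for d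
  proof (rule ccontr)
    assume "d \<notin> matching_orientation P Q"
    moreover have "dual.cob h d = 0"
    proof (rule circulation_leaving_nonneg_eq_0[OF circulation_dual_cob _ d])
      show "0 \<le> dual.cob h e" if "e \<in> D" "vert e \<in> A" "vert (\<alpha> e) \<notin> A" for e
        using gh[of e] drop[of e] that by (auto simp: indicator_def of_bool_def split: if_splits)
    qed
    ultimately show False
      using gh[OF d(1)] drop[OF d] by (simp add: indicator_def of_bool_def split: if_splits)
  qed
  have P: "arborescence P" using PQ by (simp add: tree_pair_def)
  have "reached P \<subseteq> - A"
  proof (rule reached_subsetI)
    fix d assume d: "d \<in> P" "vert (\<alpha> d) \<in> - A"
    then have "d \<in> D" using arborescenceD(2)[OF P] by blast
    then show "vert d \<in> - A"
      using leaves[of d] mem_matching_orientation_iff(2)[OF PQ, of d] d by auto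
  qed (use root in simp)
  moreover have "m \<in> g ` V"
    unfolding m_def using finite_levels v by (intro Max_in) auto
  ultimately show False
    using arborescenceD(3)[OF P] by (auto simp: A_def)
qed

lemma potential_constant:
  assumes PQ: "tree_pair P Q" and PQ': "tree_pair P' Q'"
    and gh: "\<And>d. d \<in> D \<Longrightarrow>
      indicator (matching_orientation P' Q') d - indicator (matching_orientation P Q) d = cob g d + dual.cob h d"
    and v: "v \<in> V"
  shows "g v = (g (vert d\<^sub>0) :: int)"
proof (rule antisym)
  show "g v \<le> g (vert d\<^sub>0)"
    by (rule potential_le_root[OF PQ gh v])
  have "- g v \<le> - g (vert d\<^sub>0)"
  proof (rule potential_le_root[OF PQ' _ v])
    show "indicator (matching_orientation P Q) d - indicator (matching_orientation P' Q') d =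
        cob (\<lambda>v. - g v) d + dual.cob (\<lambda>f. - h f) d" if "d \<in> D" for d
      using gh[OF that] unfolding cob_def dual.cob_def by linarith
  qed
  then show "g (vert d\<^sub>0) \<le> g v" by simp
qed

end

section \<open>Injectivity\<close>

context combinatorial_map
begin

interpretation dual: combinatorial_map D \<alpha> "\<alpha> \<circ> \<sigma>" face vert d\<^sub>0
  by (rule dual)

definition dart_matching :: "'d set \<Rightarrow> 'd set \<Rightarrow> bool" where
  "dart_matching P Q \<longleftrightarrow> P \<subseteq> D \<and> Q \<subseteq> D \<and>
    bij_betw vert P (V - {vert d\<^sub>0}) \<and> bij_betw face Q (F - {face d\<^sub>0}) \<and> edge_partition P Q"

theorem dart_matching_iff_tree_pair: "dart_matching P Q \<longleftrightarrow> tree_pair P Q"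
proof
  assume PQ: "dart_matching P Q"
  then have "parent_choice P" "dual.parent_choice Q"
    by (simp_all add: dart_matching_def parent_choice_def dual.parent_choice_def bij_betw_def)
  moreover have "corners_covered P Q"
    using PQ edge_partition_covered by (simp add: corners_covered_def dart_matching_def)
  ultimately show "tree_pair P Q"
    using corners_covered_imp_arborescences PQ by (simp add: tree_pair_def dart_matching_def)
next
  assume "tree_pair P Q"
  then have P: "arborescence P" and Q: "dual.arborescence Q" and part: "edge_partition P Q"
    by (simp_all add: tree_pair_def)
  show "dart_matching P Q"
    unfolding dart_matching_def bij_betw_def
    using parent_choiceD(1,2)[OF arborescenceD(1)[OF P]] arborescence_image[OF P]
      dual.parent_choiceD(1,2)[OF dual.arborescenceD(1)[OF Q]] dual.arborescence_image[OF Q] part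
    by (intro conjI)
qed

lemma edge_partition_dual: "dual.edge_partition Q P \<longleftrightarrow> edge_partition P Q"
  by (simp add: edge_partition_def dual.edge_partition_def add_ac)

lemma tree_pair_dual: "dual.tree_pair Q P \<longleftrightarrow> tree_pair P Q"
  using edge_partition_dual by (auto simp: tree_pair_def dual.tree_pair_def)

lemma equivalent_dual: "dual.equivalent x y \<longleftrightarrow> equivalent x y"
  unfolding equivalent_def dual.equivalent_def by (subst ex_comm) (simp add: add.commute)

lemma matching_orientation_dual:
  assumes "tree_pair P Q"
  shows "dual.matching_orientation Q P = D - matching_orientation P Q"
  using mem_matching_orientation_iff(2)[OF assms] matching_orientation_subset
    dual.mem_matching_orientation_iff(1)[OF assms[folded tree_pair_dual]]
    dual.matching_orientation_subset[OF assms[folded tree_pair_dual]] by blast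

lemma equivalent_matching_orientations_eq:
  assumes PQ: "tree_pair P Q" and PQ': "tree_pair P' Q'"
    and equiv: "equivalent (indicator (matching_orientation P Q)) (indicator (matching_orientation P' Q'))"
  shows "matching_orientation P Q = matching_orientation P' Q'"
proof -
  let ?O = "matching_orientation P Q" and ?O' = "matching_orientation P' Q'"
  obtain g h where gh: "\<And>d. d \<in> D \<Longrightarrow> indicator ?O' d - (indicator ?O d :: int) = cob g d + dual.cob h d"
    using equiv unfolding equivalent_def by blast
  have g: "g (vert d) = g (vert d\<^sub>0)" if "d \<in> D" for d
    by (rule potential_constant[OF PQ PQ' gh]) (use that in auto)
  have h: "- h (face d) = - h (face d\<^sub>0)" if "d \<in> D" for d
  proof (rule dual.potential_constant[OF PQ[folded tree_pair_dual] PQ'[folded tree_pair_dual]])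
    fix e assume e: "e \<in> D"
    show "indicator (dual.matching_orientation Q' P') e - indicator (dual.matching_orientation Q P) e =
        dual.cob (\<lambda>f. - h f) e + cob (\<lambda>v. - g v) e"
      unfolding matching_orientation_dual[OF PQ] matching_orientation_dual[OF PQ']
      using gh[OF e] e by (auto simp: indicator_def of_bool_def cob_def dual.cob_def split: if_splits)
  qed (use that in auto)
  have "d \<in> ?O' \<longleftrightarrow> d \<in> ?O" if "d \<in> D" for d
    using gh[OF that] g[OF that] g[OF \<alpha>_in[OF that]] h[OF that] h[OF \<alpha>_in[OF that]]
    by (simp add: cob_def dual.cob_def indicator_def of_bool_def split: if_splits)
  then show ?thesis
    using matching_orientation_subset[OF PQ] matching_orientation_subset[OF PQ'] by blast
qed

theorem matching_orientation_inj:
  assumes PQ: "tree_pair P Q" and PQ': "tree_pair P' Q'"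
    and eq: "matching_orientation P Q = matching_orientation P' Q'"
  shows "P = P'" "Q = Q'"
proof -
  have arb: "arborescence P" "arborescence P'" "dual.arborescence Q" "dual.arborescence Q'"
    using PQ PQ' by (auto simp: tree_pair_def)
  note choice = arborescenceD(1)[OF arb(1)] arborescenceD(1)[OF arb(2)]
    dual.arborescenceD(1)[OF arb(3)] dual.arborescenceD(1)[OF arb(4)]
  have "edge_covered (P \<inter> P') (Q \<inter> Q') d"
    if d: "d \<in> D" "vert d \<in> reached (P \<inter> P')" "face d \<in> dual.reached (Q \<inter> Q')" for d
  proof -
    have "d \<in> P \<longleftrightarrow> d \<in> P'" "d \<in> Q \<longleftrightarrow> d \<in> Q'"
      using parent_choice_reached_dart(1)[OF choice(1) _ _ d(2)] parent_choice_reached_dart(1)[OF choice(2) _ _ d(2)]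
        dual.parent_choice_reached_dart(1)[OF choice(3) _ _ d(3)] dual.parent_choice_reached_dart(1)[OF choice(4) _ _ d(3)]
      by blast+
    then show ?thesis
      using mem_matching_orientation_iff[OF PQ d(1)] mem_matching_orientation_iff[OF PQ' d(1)]
        eq edge_partitionD[of P Q d] edge_partitionD[of P' Q' d] PQ PQ' d(1)
      unfolding edge_covered_def tree_pair_def by blast
  qed
  then have "corners_covered (P \<inter> P') (Q \<inter> Q')"
    by (simp add: corners_covered_def)
  moreover have "parent_choice (P \<inter> P')" "dual.parent_choice (Q \<inter> Q')"
    using parent_choice_subset[OF choice(1)] dual.parent_choice_subset[OF choice(3)] by auto
  ultimately have "arborescence (P \<inter> P')" "dual.arborescence (Q \<inter> Q')"
    using corners_covered_imp_arborescences by blast+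
  then show "P = P'" "Q = Q'"
    using arborescence_subset_eq[OF arb(1)] arborescence_subset_eq[OF arb(2)]
      dual.arborescence_subset_eq[OF arb(3)] dual.arborescence_subset_eq[OF arb(4)]
    by (metis Int_lower1 Int_lower2)+
qed

end

section \<open>Every class contains an orientation\<close>

context combinatorial_map
begin

interpretation dual: combinatorial_map D \<alpha> "\<alpha> \<circ> \<sigma>" face vert d\<^sub>0
  by (rule dual)

text \<open>Among the quasi-orientations, the orientations minimize the energy: every summand is odd.\<close>
definition energy :: "('d \<Rightarrow> int) \<Rightarrow> nat" where
  "energy u = nat (\<Sum>d\<in>D. \<bar>2 * u d - 1\<bar>)"

lemma energy_complement: "energy (\<lambda>d. 1 - u d) = energy u"
  unfolding energy_def by (rule arg_cong[where f = nat], rule sum.cong) auto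

lemma energy_less:
  assumes "\<And>d. d \<in> D \<Longrightarrow> \<bar>2 * u' d - 1\<bar> \<le> \<bar>2 * u d - 1\<bar>"
    and "e \<in> D" "\<bar>2 * u' e - 1\<bar> < \<bar>2 * u e - 1\<bar>"
  shows "energy u' < energy u"
proof -
  have "(\<Sum>d\<in>D. \<bar>2 * u' d - 1\<bar>) < (\<Sum>d\<in>D. \<bar>2 * u d - 1\<bar>)"
    by (rule sum_strict_mono_ex1) (use finite_D assms in auto)
  moreover have "0 \<le> (\<Sum>d\<in>D. \<bar>2 * u' d - 1\<bar>)"
    by (rule sum_nonneg) simp
  ultimately show ?thesis
    unfolding energy_def by linarith
qed

lemma cut_decreases_energy:
  assumes u: "quasi_orientation u" and d: "d \<in> D" "2 \<le> u d"
    and cut: "(vert (\<alpha> d), vert d) \<notin> (steps {e \<in> D. u e \<le> 0})\<^sup>*"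
  obtains u' where "equivalent u u'" "energy u' < energy u"
proof -
  define R where "R = (steps {e \<in> D. u e \<le> 0})\<^sup>* `` {vert (\<alpha> d)}"
  define u' where "u' e = u e + cob (\<lambda>v. - indicator R v) e" for e
  have enter: "1 \<le> u e" if "e \<in> D" "vert e \<notin> R" "vert (\<alpha> e) \<in> R" for e
  proof (rule ccontr)
    assume "\<not> 1 \<le> u e"
    then have "(vert (\<alpha> e), vert e) \<in> steps {e \<in> D. u e \<le> 0}"
      using that(1) by (intro stepsI) auto
    then show False
      using that(2,3) by (auto simp: R_def intro: rtrancl_into_rtrancl)
  qed
  have "\<bar>2 * u' e - 1\<bar> \<le> \<bar>2 * u e - 1\<bar>" if "e \<in> D" for e
    using enter[of e] enter[of "\<alpha> e"] quasi_orientationD[OF u that] that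
    by (cases "vert e \<in> R"; cases "vert (\<alpha> e) \<in> R") (auto simp: cob_def u'_def)
  moreover have "vert (\<alpha> d) \<in> R" "vert d \<notin> R"
    using cut by (auto simp: R_def)
  then have "\<bar>2 * u' d - 1\<bar> < \<bar>2 * u d - 1\<bar>"
    using d by (simp add: cob_def u'_def)
  ultimately have "energy u' < energy u"
    using energy_less[of u' u d] d(1) by blast
  moreover have "equivalent u u'"
    unfolding u'_def by (rule equivalent_add_cob)
  ultimately show ?thesis using that by blast
qed

end

context planar_map
begin

interpretation dual: planar_map D \<alpha> "\<alpha> \<circ> \<sigma>" face vert d\<^sub>0
  by (rule dual_planar)

text \<open>The circulation of the dual walk is the coboundary of a function on vertices that is monotone
  along all steps outside U.\<close>
lemma dual_closed_walk_blocks_walk: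
  assumes U: "orientation U" and d: "d \<in> U" and walk: "(face d, face (\<alpha> d)) \<in> (dual.steps U)\<^sup>*"
  shows "(vert (\<alpha> d), vert d) \<notin> (steps (D - U))\<^sup>*"
proof
  have dD: "d \<in> D" "\<alpha> d \<notin> U"
    using orientationD[OF U] d by auto
  obtain z :: "'d \<Rightarrow> int" where z: "dual.circulation z" "z d \<noteq> 0"
    and z_nonneg: "\<And>e. e \<in> D \<Longrightarrow> \<alpha> e \<notin> insert d U \<Longrightarrow> 0 \<le> z e"
    using dual.closed_walk_circulation[OF walk orientationD(1)[OF U] dD] by blast
  obtain g where g: "\<And>e. e \<in> D \<Longrightarrow> z e = cob g e"
    using dual.circulation_is_dual_cob[OF z(1)] by blast
  have nonneg: "0 \<le> cob g e" if "e \<in> D" "e \<in> U" for e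
    using z_nonneg[of e] g[of e] that d orientationD(2)[OF U] by (simp add: insert_absorb)
  assume "(vert (\<alpha> d), vert d) \<in> (steps (D - U))\<^sup>*"
  then have "g (vert (\<alpha> d)) \<le> g (vert d)"
  proof induction
    case (step u v)
    then obtain e where "e \<in> D - U" "u = vert (\<alpha> e)" "v = vert e"
      by (auto simp: steps_def)
    then show ?case
      using step.IH nonneg[of "\<alpha> e"] orientationD(2)[OF U] by (simp add: cob_def)
  qed simp
  then show False
    using nonneg[OF dD(1) d] g[OF dD(1)] z(2) by (simp add: cob_def)
qed

lemma energy_reducible:
  assumes u: "quasi_orientation u" and d: "d \<in> D" "2 \<le> u d"
  obtains u' where "equivalent u u'" "energy u' < energy u"
proof (cases "(vert (\<alpha> d), vert d) \<in> (steps {e \<in> D. u e \<le> 0})\<^sup>*")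
  case False
  then show ?thesis
    using cut_decreases_energy[OF u d] that by blast
next
  case True
  define U where "U = {e \<in> D. 1 \<le> u e}"
  have U: "orientation U" "d \<in> U" "{e \<in> D. u e \<le> 0} = D - U" "{e \<in> D. 1 - u e \<le> 0} = U"
    using orientation_positive[OF u] d by (auto simp: U_def)
  then have "(face d, face (\<alpha> d)) \<notin> (dual.steps U)\<^sup>*"
    using dual_closed_walk_blocks_walk True by metis
  then obtain w where w: "dual.equivalent (\<lambda>e. 1 - u e) w" "energy w < energy (\<lambda>e. 1 - u e)"
    using dual.cut_decreases_energy[of "\<lambda>e. 1 - u e" "\<alpha> d"] quasi_orientation_complement[OF u]
      quasi_orientationD[OF u d(1)] d U(4) by auto
  have "equivalent u (\<lambda>e. 1 - w e)"
    using equivalent_complement[of "\<lambda>e. 1 - u e" w] w(1) equivalent_dual by simp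
  moreover have "energy (\<lambda>e. 1 - w e) < energy u"
    using w(2) by (simp add: energy_complement)
  ultimately show ?thesis using that by blast
qed

lemma quasi_orientation_equivalent_orientation:
  assumes "quasi_orientation u"
  shows "\<exists>U. orientation U \<and> equivalent u (indicator U)"
  using assms
proof (induction "energy u" arbitrary: u rule: less_induct)
  case less
  note u = less.prems
  show ?case
  proof (cases "\<exists>d\<in>D. 2 \<le> u d")
    case True
    then obtain u' where u': "equivalent u u'" "energy u' < energy u"
      using energy_reducible[OF u] by blast
    then show ?thesis
      using less.hyps[OF u'(2) quasi_orientation_equivalent[OF u u'(1)]] equivalent_trans[OF u'(1)] by blast
  next
    case False
    have "u d = indicator {d \<in> D. 1 \<le> u d} d" if d: "d \<in> D" for d
    proof -
      have "u d < 2" "u (\<alpha> d) < 2"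
        using False d by (auto simp: not_le)
      then show ?thesis
        using quasi_orientationD[OF u d] d by (auto simp: indicator_def)
    qed
    then have "equivalent u (indicator {d \<in> D. 1 \<le> u d})"
      using equivalent_refl equivalent_cong[of u u u] by blast
    then show ?thesis
      using orientation_positive[OF u] by blast
  qed
qed

end

section \<open>Reversing directed cuts and cycles\<close>

context combinatorial_map
begin

interpretation dual: combinatorial_map D \<alpha> "\<alpha> \<circ> \<sigma>" face vert d\<^sub>0
  by (rule dual)

definition unreached :: "'d set \<Rightarrow> nat" where
  "unreached U = card (V - reached (D - U)) + card (F - dual.reached U)"

lemma leaving_reached_notin:
  assumes U: "orientation U" and d: "d \<in> D" "vert d \<in> reached (D - U)" "vert (\<alpha> d) \<notin> reached (D - U)"
  shows "d \<notin> U"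
  using reached_step[of "\<alpha> d" "D - U"] d orientationD(2)[OF U] by auto

definition reverse_cut :: "'d set \<Rightarrow> 'v set \<Rightarrow> 'd set" where
  "reverse_cut U R = {d \<in> D. if vert d \<in> R \<longleftrightarrow> vert (\<alpha> d) \<in> R then d \<in> U else vert d \<in> R}"

lemma orientation_reverse_cut: "orientation U \<Longrightarrow> orientation (reverse_cut U R)"
  by (auto simp: orientation_def reverse_cut_def)

lemma indicator_reverse_reached_cut:
  assumes U: "orientation U" and d: "d \<in> D"
  defines "R \<equiv> reached (D - U)"
  shows "indicator (reverse_cut U R) d = indicator U d + (cob (\<lambda>v. - indicator R v) d :: int)"
  using leaving_reached_notin[OF U, of d] leaving_reached_notin[OF U, of "\<alpha> d"] orientationD(2)[OF U d] d
  by (cases "vert d \<in> R"; cases "vert (\<alpha> d) \<in> R")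
    (simp_all add: R_def cob_def reverse_cut_def indicator_def)

lemma reached_reverse_reached_cut:
  assumes "\<not> V \<subseteq> reached (D - U)"
  shows "reached (D - U) \<subset> reached (D - reverse_cut U (reached (D - U)))"
proof -
  define R where "R = reached (D - U)"
  let ?W = "reverse_cut U R"
  have sub: "v \<in> reached (D - ?W)" if "v \<in> R" for v
    using that unfolding R_def
  proof (induction rule: reached_induct)
    case (step d)
    then have "vert (\<alpha> d) \<in> R" "vert d \<in> R"
      unfolding R_def by (auto intro: reached_step)
    then have "d \<in> D - ?W"
      using step(1) by (auto simp: reverse_cut_def)
    then show ?case
      using step.IH unfolding R_def by (rule reached_step)
  qed simp
  obtain d where d: "d \<in> D" "vert d \<in> R" "vert (\<alpha> d) \<notin> R"
    using V_subsetI[of R] assms by (auto simp: R_def)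
  then have "\<alpha> d \<in> D - ?W"
    by (auto simp: reverse_cut_def)
  then have "vert (\<alpha> d) \<in> reached (D - ?W)"
    using reached_step[of "\<alpha> d" "D - ?W"] d sub by auto
  then show ?thesis
    using sub d(3) unfolding R_def by blast
qed

end

context combinatorial_map
begin

interpretation dual: combinatorial_map D \<alpha> "\<alpha> \<circ> \<sigma>" face vert d\<^sub>0
  by (rule dual)

lemma dual_reached_cut_invariant:
  assumes U: "orientation U" and W: "orientation W"
    and g: "\<And>d. d \<in> D \<Longrightarrow> indicator W d = indicator U d + (cob g d :: int)"
  shows "dual.reached W \<subseteq> dual.reached U"
proof (rule dual.reached_subsetI)
  let ?R = "dual.reached U"
  fix d assume d: "d \<in> W" "face (\<alpha> d) \<in> ?R"
  have dD: "d \<in> D" "\<alpha> d \<notin> W"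
    using orientationD[OF W] d by auto
  have in_U: "e \<in> U" if "e \<in> D" "face e \<in> ?R" "face (\<alpha> e) \<notin> ?R" for e
    using dual.leaving_reached_notin[OF orientation_complement[OF U], of e] that orientationD(1)[OF U]
    by (auto simp: double_diff)
  show "face d \<in> ?R"
  proof (rule ccontr)
    assume new: "face d \<notin> ?R"
    have "- cob g (\<alpha> d) = 0"
    proof (rule dual.circulation_leaving_nonneg_eq_0[OF dual.circulation_uminus[OF dual.circulation_dual_cob]])
      show "0 \<le> - cob g e" if "e \<in> D" "face e \<in> ?R" "face (\<alpha> e) \<notin> ?R" for e
        using g[OF that(1)] in_U[OF that] by (simp add: indicator_def of_bool_def split: if_splits)
    qed (use d dD new in auto)
    then show False
      using g[of "\<alpha> d"] in_U[of "\<alpha> d"] d dD new by simp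
  qed
qed simp

lemma reverse_decreases_unreached:
  assumes U: "orientation U" and R: "\<not> V \<subseteq> reached (D - U)"
  obtains W where "orientation W" "equivalent (indicator U) (indicator W)" "unreached W < unreached U"
proof -
  define W where "W = reverse_cut U (reached (D - U))"
  obtain g where g: "\<And>d. d \<in> D \<Longrightarrow> indicator W d = indicator U d + (cob g d :: int)"
    using indicator_reverse_reached_cut[OF U] unfolding W_def by blast
  have W: "orientation W" and grow: "reached (D - U) \<subset> reached (D - W)"
    using orientation_reverse_cut[OF U] reached_reverse_reached_cut[OF R] by (simp_all add: W_def)
  have "dual.reached U \<subseteq> dual.reached W"
    by (rule dual_reached_cut_invariant[OF W U, of "\<lambda>v. - g v"]) (use g in \<open>simp add: cob_def\<close>)
  then have "card (F - dual.reached W) \<le> card (F - dual.reached U)"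
    using finite_D by (intro card_mono) auto
  moreover have "card (V - reached (D - W)) < card (V - reached (D - U))"
    using grow reached_subset_V[of "D - W"] finite_D by (intro psubset_card_mono) auto
  ultimately have "unreached W < unreached U"
    by (simp add: unreached_def)
  moreover have "equivalent (indicator U) (indicator W)"
    by (rule equivalentI[of _ _ g "\<lambda>_. 0"]) (use g in \<open>simp add: dual.cob_def\<close>)
  ultimately show ?thesis using that W by blast
qed

end

context combinatorial_map
begin

interpretation dual: combinatorial_map D \<alpha> "\<alpha> \<circ> \<sigma>" face vert d\<^sub>0
  by (rule dual)

lemma equivalent_indicator_complement:
  assumes "equivalent (indicator U) (indicator W)"
  shows "equivalent (indicator (D - U)) (indicator (D - W))"
proof -
  have "equivalent (indicator (D - U)) (indicator (D - W)) \<longleftrightarrow>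
      equivalent (\<lambda>d. 1 - indicator U d) (\<lambda>d. 1 - indicator W d)"
    by (rule equivalent_cong) (auto simp: indicator_def)
  then show ?thesis
    using equivalent_complement[OF assms] by simp
qed

lemma unreached_dual: "U \<subseteq> D \<Longrightarrow> dual.unreached (D - U) = unreached U"
  by (simp add: unreached_def dual.unreached_def double_diff)

lemma unreached_reducible:
  assumes U: "orientation U" and unreached: "\<not> (V \<subseteq> reached (D - U) \<and> F \<subseteq> dual.reached U)"
  obtains W where "orientation W" "equivalent (indicator U) (indicator W)" "unreached W < unreached U"
proof (cases "V \<subseteq> reached (D - U)")
  case False
  then show ?thesis
    using reverse_decreases_unreached[OF U] that by blast
next
  case True
  note U_D = orientationD(1)[OF U]
  have "\<not> F \<subseteq> dual.reached (D - (D - U))"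
    using unreached True U_D by (simp add: double_diff)
  then obtain W where W: "orientation W" "equivalent (indicator (D - U)) (indicator W)"
    "dual.unreached W < dual.unreached (D - U)"
    using dual.reverse_decreases_unreached[OF orientation_complement[OF U]] equivalent_dual by metis
  have "equivalent (indicator U) (indicator (D - W))"
    using equivalent_indicator_complement[OF W(2)] U_D by (simp add: double_diff)
  moreover have "unreached (D - W) < unreached U"
    using W(3) unreached_dual[OF U_D] unreached_dual[of "D - W"] orientationD(1)[OF W(1)]
    by (simp add: double_diff)
  ultimately show ?thesis
    using that orientation_complement[OF W(1)] by blast
qed

lemma equivalent_orientation_reaching_all:
  assumes "orientation U"
  shows "\<exists>W. orientation W \<and> equivalent (indicator U) (indicator W) \<and> V \<subseteq> reached (D - W) \<and> F \<subseteq> dual.reached W"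
  using assms
proof (induction "unreached U" arbitrary: U rule: less_induct)
  case less
  show ?case
  proof (cases "V \<subseteq> reached (D - U) \<and> F \<subseteq> dual.reached U")
    case True
    then show ?thesis
      using less.prems equivalent_refl by blast
  next
    case False
    then obtain W where "orientation W" "equivalent (indicator U) (indicator W)" "unreached W < unreached U"
      using unreached_reducible[OF less.prems] by blast
    then show ?thesis
      using less.hyps equivalent_trans by blast
  qed
qed

end

section \<open>Matchings from orientations\<close>

context combinatorial_map
begin

interpretation dual: combinatorial_map D \<alpha> "\<alpha> \<circ> \<sigma>" face vert d\<^sub>0
  by (rule dual)

text \<open>Reachability of all vertices and faces survives the growth of P and Q because a dart enters P
  only when Q has reached its face, and dually.\<close>
definition growing_pair :: "'d set \<Rightarrow> 'd set \<Rightarrow> 'd set \<Rightarrow> bool" where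
  "growing_pair U P Q \<longleftrightarrow> parent_choice P \<and> dual.parent_choice Q \<and>
    P \<subseteq> D - U - \<alpha> ` Q \<and> Q \<subseteq> U - \<alpha> ` P \<and> vert ` P \<subseteq> reached P \<and> face ` Q \<subseteq> dual.reached Q \<and>
    V \<subseteq> reached (D - U - \<alpha> ` Q) \<and> F \<subseteq> dual.reached (U - \<alpha> ` P)"

lemma growing_pairD:
  assumes "growing_pair U P Q"
  shows "parent_choice P" "dual.parent_choice Q" "P \<subseteq> D - U - \<alpha> ` Q" "Q \<subseteq> U - \<alpha> ` P"
    "vert ` P \<subseteq> reached P" "face ` Q \<subseteq> dual.reached Q"
    "V \<subseteq> reached (D - U - \<alpha> ` Q)" "F \<subseteq> dual.reached (U - \<alpha> ` P)"
  using assms by (simp_all add: growing_pair_def)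

end

context planar_map
begin

interpretation dual: planar_map D \<alpha> "\<alpha> \<circ> \<sigma>" face vert d\<^sub>0
  by (rule dual_planar)

lemma growing_pair_faces_reached:
  assumes U: "orientation U" and PQ: "growing_pair U P Q"
    and d: "d \<in> U" "face d \<in> dual.reached Q" "d \<notin> Q"
  shows "F \<subseteq> dual.reached (U - \<alpha> ` insert (\<alpha> d) P)"
proof -
  let ?B = "U - \<alpha> ` insert (\<alpha> d) P"
  have dD: "\<alpha> (\<alpha> d) = d"
    using orientationD(1)[OF U] d(1) by auto
  have "Q \<subseteq> ?B"
    using growing_pairD(4)[OF PQ] d(3) dD by auto
  then have "face d \<in> dual.reached ?B"
    using d(2) dual.reached_mono by blast
  then have "dual.reached (U - \<alpha> ` P) \<subseteq> dual.reached ?B"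
    using dD by (intro dual.reached_subsetI) (auto intro: dual.reached_step)
  then show ?thesis
    using growing_pairD(8)[OF PQ] by blast
qed

lemma growing_pair_fresh_vertex:
  assumes U: "orientation U" and PQ: "growing_pair U P Q"
    and d: "d \<in> U" "vert d \<in> reached P" "face d \<in> dual.reached Q" "\<alpha> d \<notin> P" "d \<notin> Q"
  shows "vert (\<alpha> d) \<notin> reached P"
proof
  assume "vert (\<alpha> d) \<in> reached P"
  let ?T = "P \<union> \<alpha> ` P"
  note pair = growing_pairD[OF PQ]
  have dD: "d \<in> D" "\<alpha> d \<notin> U" "d \<notin> P"
    using orientationD[OF U] d(1) pair(3) by auto
  have T: "edge_closed ?T"
    by (rule edge_closed_Un_image[OF parent_choiceD(1)[OF pair(1)]])
  have "(vert d, vert (\<alpha> d)) \<in> (steps ?T)\<^sup>*"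
    using reached_connected[OF T] reached_mono[of P ?T] d(2) \<open>vert (\<alpha> d) \<in> reached P\<close> by auto
  moreover have "d \<notin> ?T"
    using dD d(4) mem_image_\<alpha>_iff[OF parent_choiceD(1)[OF pair(1)]] by simp
  moreover have "U - \<alpha> ` insert (\<alpha> d) P \<subseteq> D - ?T - edge d"
    using pair(3) orientationD(1)[OF U] dD by auto
  then have "F \<subseteq> dual.reached (D - ?T - edge d)"
    using growing_pair_faces_reached[OF U PQ d(1,3,5)] dual.reached_mono by blast
  then have "face d \<in> dual.reached (D - ?T - edge d)" "face (\<alpha> d) \<in> dual.reached (D - ?T - edge d)"
    using dD(1) \<alpha>_in by blast+
  ultimately show False
    using closed_walk_separates[OF T dD(1)] by blast
qed

lemma growing_pair_insert:
  assumes U: "orientation U" and PQ: "growing_pair U P Q"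
    and d: "d \<in> U" "vert d \<in> reached P" "face d \<in> dual.reached Q" "\<alpha> d \<notin> P" "d \<notin> Q"
  shows "growing_pair U (insert (\<alpha> d) P) Q"
proof -
  note pair = growing_pairD[OF PQ]
  have dD: "d \<in> D" "\<alpha> d \<notin> U"
    using orientationD[OF U] d(1) by auto
  have "\<alpha> d \<notin> \<alpha> ` Q"
    using mem_image_\<alpha>_iff[of Q "\<alpha> d"] dual.parent_choiceD(1)[OF pair(2)] d(5) dD(1) by simp
  then have "insert (\<alpha> d) P \<subseteq> D - U - \<alpha> ` Q"
    using pair(3) dD by simp
  moreover have "Q \<subseteq> U - \<alpha> ` insert (\<alpha> d) P"
    using pair(4) d(5) dD(1) by auto
  moreover have "parent_choice (insert (\<alpha> d) P)" "vert ` insert (\<alpha> d) P \<subseteq> reached (insert (\<alpha> d) P)"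
    using reached_insert_leaf[OF pair(1,5), of "\<alpha> d"] growing_pair_fresh_vertex[OF U PQ d] d(2) dD(1)
    by simp_all
  moreover have "F \<subseteq> dual.reached (U - \<alpha> ` insert (\<alpha> d) P)"
    by (rule growing_pair_faces_reached[OF U PQ d(1,3,5)])
  ultimately show ?thesis
    unfolding growing_pair_def using pair(2,6,7) by blast
qed

end

context planar_map
begin

interpretation dual: planar_map D \<alpha> "\<alpha> \<circ> \<sigma>" face vert d\<^sub>0
  by (rule dual_planar)

lemma growing_pair_dual: "U \<subseteq> D \<Longrightarrow> dual.growing_pair (D - U) Q P \<longleftrightarrow> growing_pair U P Q"
  unfolding growing_pair_def dual.growing_pair_def by (simp add: double_diff conj_ac)

lemma growing_pair_extend:
  assumes U: "orientation U" and PQ: "growing_pair U P Q"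
    and d: "d \<in> D" "vert d \<in> reached P" "face d \<in> dual.reached Q" "\<not> edge_covered P Q d"
  shows "growing_pair U (insert (\<alpha> d) P) Q \<or> growing_pair U P (insert (\<alpha> d) Q)"
proof (cases "d \<in> U")
  case True
  then show ?thesis
    using growing_pair_insert[OF U PQ] d by (simp add: edge_covered_def)
next
  case False
  then have "dual.growing_pair (D - U) (insert (\<alpha> d) Q) P"
    using dual.growing_pair_insert[OF orientation_complement[OF U]] growing_pair_dual[OF orientationD(1)[OF U]] PQ d
    by (simp add: edge_covered_def)
  then show ?thesis
    using growing_pair_dual[OF orientationD(1)[OF U]] by simp
qed

lemma maximal_growing_pair_exists:
  assumes U: "orientation U" and V: "V \<subseteq> reached (D - U)" and F: "F \<subseteq> dual.reached U"
  obtains P Q where "growing_pair U P Q" "corners_covered P Q"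
proof -
  let ?size = "\<lambda>(P :: 'd set, Q :: 'd set). card P + card Q"
  have sub: "P \<subseteq> D \<and> Q \<subseteq> D" if "growing_pair U P Q" for P Q
    using growing_pairD(3,4)[OF that] orientationD(1)[OF U] by blast
  have "case_prod (growing_pair U) ({}, {})"
    using V F by (simp add: growing_pair_def parent_choice_def dual.parent_choice_def)
  moreover have "\<forall>PQ. case_prod (growing_pair U) PQ \<longrightarrow> ?size PQ < card D + card D + 1"
    using sub card_mono[OF finite_D] by (auto simp: less_Suc_eq_le intro!: add_mono)
  ultimately have "\<exists>PQ. case_prod (growing_pair U) PQ \<and> (\<forall>PQ'. case_prod (growing_pair U) PQ' \<longrightarrow> ?size PQ' \<le> ?size PQ)"
    by (rule ex_has_greatest_nat)
  then obtain P Q where PQ: "growing_pair U P Q"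
    and maximal: "\<And>P' Q'. growing_pair U P' Q' \<Longrightarrow> card P' + card Q' \<le> card P + card Q"
    by auto
  have finite_PQ: "finite P" "finite Q"
    using sub[OF PQ] finite_D finite_subset by blast+
  have "edge_covered P Q d" if d: "d \<in> D" "vert d \<in> reached P" "face d \<in> dual.reached Q" for d
  proof (rule ccontr)
    assume uncovered: "\<not> edge_covered P Q d"
    then have "\<alpha> d \<notin> P" "\<alpha> d \<notin> Q"
      by (simp_all add: edge_covered_def)
    then show False
      using growing_pair_extend[OF U PQ d uncovered] maximal finite_PQ by fastforce
  qed
  then show ?thesis
    using that PQ by (simp add: corners_covered_def)
qed

theorem tree_pair_of_orientation:
  assumes U: "orientation U" and V: "V \<subseteq> reached (D - U)" and F: "F \<subseteq> dual.reached U"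
  obtains P Q where "tree_pair P Q" "matching_orientation P Q = U"
proof -
  obtain P Q where PQ: "growing_pair U P Q" and cov: "corners_covered P Q"
    using maximal_growing_pair_exists[OF assms] by blast
  note pair = growing_pairD[OF PQ]
  have arb: "arborescence P" "dual.arborescence Q"
    using corners_covered_imp_arborescences[OF pair(1,2) cov] by simp_all
  note mem = mem_image_\<alpha>_iff[OF arborescenceD(2)[OF arb(1)]] mem_image_\<alpha>_iff[OF dual.arborescenceD(2)[OF arb(2)]]
  have cases: "(d \<in> U \<longrightarrow> d \<notin> P \<and> \<alpha> d \<notin> Q \<and> (\<alpha> d \<in> P \<longleftrightarrow> d \<notin> Q)) \<and>
      (d \<notin> U \<longrightarrow> d \<notin> Q \<and> \<alpha> d \<notin> P \<and> (\<alpha> d \<in> Q \<longleftrightarrow> d \<notin> P))" if d: "d \<in> D" for d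
  proof -
    have "edge_covered P Q d"
      using cov d arborescenceD(3)[OF arb(1)] dual.arborescenceD(3)[OF arb(2)] by (simp add: corners_covered_def)
    then show ?thesis
      using pair(3,4) mem[OF d] orientationD(2)[OF U d] unfolding edge_covered_def by blast
  qed
  have "edge_partition P Q"
    unfolding edge_partition_def using cases by (auto split: if_splits)
  then have "tree_pair P Q"
    using arb by (simp add: tree_pair_def)
  moreover have "matching_orientation P Q = U"
    using cases mem_matching_orientation_iff(1)[OF \<open>tree_pair P Q\<close>]
      matching_orientation_subset[OF \<open>tree_pair P Q\<close>] orientationD(1)[OF U] by blast
  ultimately show ?thesis by (rule that)
qed

theorem quasi_orientation_equivalent_matching_orientation:
  assumes "quasi_orientation u"
  obtains P Q where "tree_pair P Q" "equivalent u (indicator (matching_orientation P Q))"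
proof -
  obtain U where U: "orientation U" "equivalent u (indicator U)"
    using quasi_orientation_equivalent_orientation[OF assms] by blast
  obtain W where W: "orientation W" "equivalent (indicator U) (indicator W)"
    "V \<subseteq> reached (D - W)" "F \<subseteq> dual.reached W"
    using equivalent_orientation_reaching_all[OF U(1)] by blast
  obtain P Q where "tree_pair P Q" "matching_orientation P Q = W"
    by (rule tree_pair_of_orientation[OF W(1,3,4)])
  then show ?thesis
    using that equivalent_trans[OF U(2) W(2)] by blast
qed

end

section \<open>Spanning trees\<close>

context combinatorial_map
begin

definition spanning_darts :: "'d set \<Rightarrow> bool" where
  "spanning_darts T \<longleftrightarrow> edge_closed T \<and> V \<subseteq> reached T \<and>
    (\<forall>d\<in>T. (vert d, vert (\<alpha> d)) \<notin> (steps (T - edge d))\<^sup>*)"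

definition path_darts :: "'d set \<Rightarrow> 'v \<Rightarrow> 'v \<Rightarrow> 'd set" where
  "path_darts T u v = {e \<in> T. (u, v) \<notin> (steps (T - edge e))\<^sup>*}"

definition cycle_darts :: "'d set \<Rightarrow> 'd \<Rightarrow> 'd set" where
  "cycle_darts T d = edge d \<union> path_darts T (vert (\<alpha> d)) (vert d)"

lemma spanning_dartsD:
  assumes "spanning_darts T"
  shows "edge_closed T" "T \<subseteq> D" "V \<subseteq> reached T" "d \<in> T \<Longrightarrow> (vert d, vert (\<alpha> d)) \<notin> (steps (T - edge d))\<^sup>*"
  using assms by (auto simp: spanning_darts_def edge_closed_def)

lemma edge_closed_remove_edge: "edge_closed B \<Longrightarrow> d \<in> D \<Longrightarrow> edge_closed (B - edge d)"
  by (rule edge_closed_Diff[OF _ edge_closed_edge])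

lemma spanning_arborescence_covers:
  assumes T: "spanning_darts T" and P: "P \<subseteq> T" "arborescence P"
  shows "P \<union> \<alpha> ` P = T"
proof
  note T_closed = spanning_dartsD(1)[OF T] and T_D = spanning_dartsD(2)[OF T]
  show "P \<union> \<alpha> ` P \<subseteq> T"
    using P(1) T_closed by (auto simp: edge_closed_def)
  show "T \<subseteq> P \<union> \<alpha> ` P"
  proof (rule subsetI, rule ccontr)
    fix d assume d: "d \<in> T" "d \<notin> P \<union> \<alpha> ` P"
    then have dD: "d \<in> D" using T_D by blast
    then have "P \<subseteq> T - edge d"
      using P(1) d mem_image_\<alpha>_iff[OF arborescenceD(2)[OF P(2)] dD] by auto
    then have "vert d \<in> reached (T - edge d)" "vert (\<alpha> d) \<in> reached (T - edge d)"
      using reached_mono arborescenceD(3)[OF P(2)] dD by (blast intro: \<alpha>_in)+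
    then show False
      using reached_connected[OF edge_closed_remove_edge[OF T_closed dD]] spanning_dartsD(4)[OF T d(1)] by blast
  qed
qed

lemma spanning_darts_arborescence:
  assumes T: "spanning_darts T"
  obtains P where "arborescence P" "P \<union> \<alpha> ` P = T"
    "\<And>d. d \<in> T \<Longrightarrow> d \<in> P \<longleftrightarrow> vert d \<notin> reached (T - edge d)"
proof -
  note T_closed = spanning_dartsD(1)[OF T] and T_D = spanning_dartsD(2)[OF T]
  obtain P where P: "P \<subseteq> T" "arborescence P"
    using arborescence_exists[OF T_D spanning_dartsD(3)[OF T]] by blast
  note P_T = spanning_arborescence_covers[OF T P]
  have parent: "vert (\<alpha> d) \<in> reached (T - edge d)" if d: "d \<in> P" for d
    using arborescence_remove_dart(1)[OF P(2) d] reached_mono[of "P - {d}" "T - edge d"]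
      P(1) arborescence_antisym[OF P(2) d] by blast
  have "d \<in> P \<longleftrightarrow> vert d \<notin> reached (T - edge d)" if d: "d \<in> T" for d
  proof
    have dD: "d \<in> D" using d T_D by blast
    show "vert d \<notin> reached (T - edge d)" if "d \<in> P"
      using reached_connected[OF edge_closed_remove_edge[OF T_closed dD]] parent[OF that]
        spanning_dartsD(4)[OF T d] by blast
    show "d \<in> P" if cut: "vert d \<notin> reached (T - edge d)"
    proof (rule ccontr)
      assume "d \<notin> P"
      then have "\<alpha> d \<in> P"
        using d P_T mem_image_\<alpha>_iff[OF arborescenceD(2)[OF P(2)] dD] by blast
      then show False
        using parent[of "\<alpha> d"] cut dD by (simp add: insert_commute)
    qed
  qed
  then show ?thesis using that P(2) P_T by blast
qed

lemma spanning_darts_edge_separates: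
  assumes T: "spanning_darts T" and B: "B \<subseteq> T" and e: "e \<in> T"
    and uv: "(u, v) \<in> (steps B)\<^sup>*" "(u, v) \<notin> (steps (B - edge e))\<^sup>*"
  shows "(u, v) \<notin> (steps (T - edge e))\<^sup>*"
proof
  define R where "R = (steps (T - edge e))\<^sup>*"
  have eD: "e \<in> D" using spanning_dartsD(2)[OF T] e by blast
  have R: "trans R" "sym R"
    using sym_rtrancl[OF sym_steps[OF edge_closed_remove_edge[OF spanning_dartsD(1)[OF T] eD]]]
    by (simp_all add: R_def trans_rtrancl)
  have "(steps (B - edge e))\<^sup>* \<subseteq> R"
    unfolding R_def using B by (intro rtrancl_mono steps_mono) blast
  then consider "(u, vert e) \<in> R" "(vert (\<alpha> e), v) \<in> R" | "(u, vert (\<alpha> e)) \<in> R" "(vert e, v) \<in> R"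
    using steps_remove_edge[OF uv(1) eD] uv(2) by blast
  then have endpoints: "(vert e, vert (\<alpha> e)) \<in> R" if "(u, v) \<in> R"
  proof cases
    case 1
    then show ?thesis
      using transD[OF R(1) transD[OF R(1) symD[OF R(2)] that] symD[OF R(2)]] by blast
  next
    case 2
    then show ?thesis
      using transD[OF R(1) transD[OF R(1) _ symD[OF R(2) that]]] by blast
  qed
  assume "(u, v) \<in> (steps (T - edge e))\<^sup>*"
  then show False
    using endpoints spanning_dartsD(4)[OF T e] by (simp add: R_def)
qed

text \<open>A minimal subset of the tree connecting u and v consists of edges separating u from v.\<close>
lemma path_darts_connect:
  assumes T: "spanning_darts T" and uv: "(u, v) \<in> (steps T)\<^sup>*"
  shows "(u, v) \<in> (steps (path_darts T u v))\<^sup>*"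
proof -
  note T_closed = spanning_dartsD(1)[OF T] and T_D = spanning_dartsD(2)[OF T]
  define S where "S = {B. B \<subseteq> T \<and> edge_closed B \<and> (u, v) \<in> (steps B)\<^sup>*}"
  have "finite S"
    by (rule finite_subset[of _ "Pow D"]) (use T_D finite_D in \<open>auto simp: S_def\<close>)
  moreover have "T \<in> S"
    using T_closed uv by (simp add: S_def)
  ultimately obtain B where "B \<in> S" and minimal: "\<forall>B'\<in>S. B' \<subseteq> B \<longrightarrow> B = B'"
    using finite_has_minimal[of S] by auto
  then have B: "B \<subseteq> T" "edge_closed B" "(u, v) \<in> (steps B)\<^sup>*"
    by (auto simp: S_def)
  have "(u, v) \<notin> (steps (T - edge e))\<^sup>*" if e: "e \<in> B" for e
  proof (rule spanning_darts_edge_separates[OF T B(1) _ B(3)])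
    show "e \<in> T" using B(1) e by blast
    have "B - edge e \<notin> S"
      using minimal e by (metis Diff_iff Diff_subset insertI1)
    moreover have "edge_closed (B - edge e)"
      using edge_closed_remove_edge[OF B(2)] B(1) T_D e by blast
    ultimately show "(u, v) \<notin> (steps (B - edge e))\<^sup>*"
      using B(1) unfolding S_def by blast
  qed
  then have "B \<subseteq> path_darts T u v"
    using B(1) by (auto simp: path_darts_def)
  then show ?thesis
    using rtrancl_steps_mono B(3) by blast
qed

lemma edge_closed_path_darts: "edge_closed T \<Longrightarrow> edge_closed (path_darts T u v)"
  by (auto simp: edge_closed_def path_darts_def subset_iff insert_commute)

lemma path_darts_commute:
  assumes "edge_closed T"
  shows "path_darts T u v = path_darts T v u"
  using rtrancl_steps_commute[OF edge_closed_remove_edge[OF assms]] edge_closedD(1)[OF assms]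
  by (auto simp: path_darts_def)

lemma cycle_darts_\<alpha>: "edge_closed T \<Longrightarrow> d \<in> D \<Longrightarrow> cycle_darts T (\<alpha> d) = cycle_darts T d"
  using path_darts_commute by (auto simp: cycle_darts_def)

end

context planar_map
begin

interpretation dual: planar_map D \<alpha> "\<alpha> \<circ> \<sigma>" face vert d\<^sub>0
  by (rule dual_planar)

lemma right_face_reached_off_cycle:
  assumes Q: "dual.arborescence Q" "Q \<inter> T = {}" and d: "d \<in> Q"
  shows "face (\<alpha> d) \<in> dual.reached (D - cycle_darts T d)"
proof -
  have "Q - {d} \<subseteq> D - cycle_darts T d"
    using Q(2) dual.arborescenceD(2)[OF Q(1)] dual.arborescence_antisym[OF Q(1) d]
    by (auto simp: cycle_darts_def path_darts_def)
  then show ?thesis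
    using dual.arborescence_remove_dart(1)[OF Q(1) d] dual.reached_mono by blast
qed

lemma cycle_separates_faces:
  assumes T: "spanning_darts T" and d: "d \<in> D - T"
  shows "\<not> (face d \<in> dual.reached (D - cycle_darts T d) \<and> face (\<alpha> d) \<in> dual.reached (D - cycle_darts T d))"
proof -
  let ?path = "path_darts T (vert d) (vert (\<alpha> d))"
  note T_closed = spanning_dartsD(1)[OF T]
  have dD: "d \<in> D" "d \<notin> ?path"
    using d by (auto simp: path_darts_def)
  have "(vert d, vert (\<alpha> d)) \<in> (steps T)\<^sup>*"
    using reached_connected[OF T_closed] spanning_dartsD(3)[OF T] dD(1) by (blast intro: \<alpha>_in)
  then have "(vert d, vert (\<alpha> d)) \<in> (steps ?path)\<^sup>*"
    by (rule path_darts_connect[OF T])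
  moreover have "D - ?path - edge d = D - cycle_darts T d"
    using path_darts_commute[OF T_closed] by (auto simp: cycle_darts_def)
  ultimately show ?thesis
    using closed_walk_separates[OF edge_closed_path_darts[OF T_closed] dD] by metis
qed

lemma complementary_dart_iff_enclosed:
  assumes T: "spanning_darts T" and Q: "dual.arborescence Q" "Q \<union> \<alpha> ` Q = D - T" and d: "d \<in> D - T"
  shows "d \<in> Q \<longleftrightarrow> face d \<notin> dual.reached (D - cycle_darts T d)"
proof
  have disjoint: "Q \<inter> T = {}" using Q(2) by blast
  show "face d \<notin> dual.reached (D - cycle_darts T d)" if "d \<in> Q"
    using right_face_reached_off_cycle[OF Q(1) disjoint that] cycle_separates_faces[OF T d] by blast
  show "d \<in> Q" if "face d \<notin> dual.reached (D - cycle_darts T d)"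
  proof (rule ccontr)
    assume "d \<notin> Q"
    then have "\<alpha> d \<in> Q"
      using Q(2) d mem_image_\<alpha>_iff[OF dual.arborescenceD(2)[OF Q(1)], of d] by blast
    then show False
      using right_face_reached_off_cycle[OF Q(1) disjoint] that d cycle_darts_\<alpha>[OF spanning_dartsD(1)[OF T]]
      by fastforce
  qed
qed

end

section \<open>Plane graphs\<close>

lemma orbit_self: "x \<in> orbit f x"
  unfolding orbit_def by (rule CollectI, rule exI[of _ 0]) simp

lemma orbit_step: "y \<in> orbit f x \<Longrightarrow> f y \<in> orbit f x"
  unfolding orbit_def by clarify (metis funpow.simps(2) o_apply)

lemma orbit_least:
  assumes "x \<in> X" "\<And>y. y \<in> X \<Longrightarrow> f y \<in> X"
  shows "orbit f x \<subseteq> X"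
proof -
  have "(f ^^ n) x \<in> X" for n
    by (induction n) (use assms in auto)
  then show ?thesis by (auto simp: orbit_def)
qed

lemma orbit_apply:
  assumes f: "bij_betw f D D" and fin: "finite D" and x: "x \<in> D"
  shows "orbit f (f x) = orbit f x"
proof
  show "orbit f (f x) \<subseteq> orbit f x"
    by (intro orbit_least orbit_step orbit_self)
  have inj: "inj_on f D" and in_D: "f y \<in> D" if "y \<in> D" for y
    using f that by (auto simp: bij_betw_def)
  have sub: "orbit f (f x) \<subseteq> D"
    by (rule orbit_least) (use x in_D in auto)
  have "f ` orbit f (f x) = orbit f (f x)"
    by (rule endo_inj_surj) (use sub fin inj x in \<open>auto intro: orbit_step finite_subset inj_on_subset\<close>)
  then obtain y where y: "y \<in> orbit f (f x)" "f x = f y"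
    using orbit_self[of "f x" f] by (metis imageE)
  then have "x = y"
    using inj_onD[OF inj[OF x], of x y] x sub by blast
  then show "orbit f x \<subseteq> orbit f (f x)"
    using y(1) by (intro orbit_least orbit_step) simp
qed

lemma card_edges:
  assumes "plane_map G"
  shows "2 * card (edges G) = card (darts G)"
proof -
  have fin: "finite (darts G)"
    and alp: "\<And>d. d \<in> darts G \<Longrightarrow> alp G d \<in> darts G \<and> alp G d \<noteq> d \<and> alp G (alp G d) = d"
    using assms by (auto simp: plane_map_def)
  have eq: "w = {d, alp G d}" if "w \<in> edges G" "d \<in> w" for w d
    using that alp by (auto simp: edges_def edge_of_def)
  have Union: "\<Union> (edges G) = darts G"
    using alp by (auto simp: edges_def edge_of_def)
  have "2 * card (edges G) = card (\<Union> (edges G))"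
  proof (rule card_partition)
    show "card w = 2" if w: "w \<in> edges G" for w
    proof -
      obtain d where d: "d \<in> darts G" "w = {d, alp G d}"
        using w unfolding edges_def edge_of_def by blast
      moreover have "d \<noteq> alp G d"
        using alp[OF d(1)] by metis
      ultimately show ?thesis by simp
    qed
    show "w \<inter> w' = {}" if "w \<in> edges G" "w' \<in> edges G" "w \<noteq> w'" for w w'
      using eq that by (metis disjoint_iff)
  qed (use fin Union in \<open>auto simp: edges_def\<close>)
  then show ?thesis using Union by simp
qed

locale rooted_plane_graph =
  fixes G :: "'d emb" and d\<^sub>0 :: 'd
  assumes plane: "plane_map G" and d\<^sub>0_in: "d\<^sub>0 \<in> darts G"
    and root: "vert_of G d\<^sub>0 = root G" and outer: "face_of G d\<^sub>0 = outer G"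

sublocale rooted_plane_graph \<subseteq> planar_map "darts G" "alp G" "sig G" "vert_of G" "face_of G" d\<^sub>0
proof
  have alp: "alp G d \<in> darts G \<and> alp G d \<noteq> d \<and> alp G (alp G d) = d" if "d \<in> darts G" for d
    using plane that by (auto simp: plane_map_def)
  then show "d \<in> darts G \<Longrightarrow> alp G d \<in> darts G" "d \<in> darts G \<Longrightarrow> alp G d \<noteq> d" "d \<in> darts G \<Longrightarrow> alp G (alp G d) = d" for d
    by simp_all
  show fin: "finite (darts G)" and sig: "bij_betw (sig G) (darts G) (darts G)"
    using plane by (auto simp: plane_map_def)
  show "vert_of G (sig G d) = vert_of G d" if "d \<in> darts G" for d
    unfolding vert_of_def by (rule orbit_apply[OF sig fin that])
  have "bij_betw (alp G) (darts G) (darts G)"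
    by (rule bij_betw_byWitness[where f' = "alp G"]) (use alp in auto)
  then have alp_sig: "bij_betw (alp G \<circ> sig G) (darts G) (darts G)"
    by (rule bij_betw_trans[OF sig])
  show "face_of G (alp G (sig G d)) = face_of G d" if "d \<in> darts G" for d
    using orbit_apply[OF alp_sig fin that] by (simp add: face_of_def)
  show "X = darts G"
    if X: "X \<subseteq> darts G" "X \<noteq> {}" "\<And>d. d \<in> X \<Longrightarrow> alp G d \<in> X" "\<And>d. d \<in> X \<Longrightarrow> sig G d \<in> X" for X
  proof
    obtain d where d: "d \<in> X" using X(2) by blast
    show "darts G \<subseteq> X"
    proof
      fix e assume "e \<in> darts G"
      then have "(d, e) \<in> {(x, y). x \<in> darts G \<and> (y = alp G x \<or> y = sig G x)}\<^sup>*"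
        using plane d X(1) by (auto simp: plane_map_def)
      then show "e \<in> X"
        by induction (use d X in auto)
    qed
  qed (rule X)
  show "2 * card (vert_of G ` darts G) + 2 * card (face_of G ` darts G) = card (darts G) + 4"
    using plane card_edges[OF plane] by (simp add: plane_map_def verts_def faces_def)
qed (rule d\<^sub>0_in)

context rooted_plane_graph
begin

interpretation dual: planar_map "darts G" "alp G" "alp G \<circ> sig G" "face_of G" "vert_of G" d\<^sub>0
  by (rule dual_planar)

definition darts_over :: "'d set set \<Rightarrow> 'd set" where
  "darts_over T = {d \<in> darts G. edge_of G d \<in> T}"

lemma edge_of_eq_iff: "d \<in> darts G \<Longrightarrow> e \<in> darts G \<Longrightarrow> edge_of G e = edge_of G d \<longleftrightarrow> e \<in> edge d"
  unfolding edge_of_def by (auto simp: doubleton_eq_iff)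

lemma edge_of_alp [simp]: "d \<in> darts G \<Longrightarrow> edge_of G (alp G d) = edge_of G d"
  by (auto simp: edge_of_def)

lemma edge_closed_darts_over: "edge_closed (darts_over T)"
  by (auto simp: edge_closed_def darts_over_def)

lemma darts_over_remove: "d \<in> darts G \<Longrightarrow> darts_over (T - {edge_of G d}) = darts_over T - edge d"
  using edge_of_eq_iff by (auto simp: darts_over_def)

lemma conn_iff: "conn G T u v \<longleftrightarrow> (u, v) \<in> (steps (darts_over T))\<^sup>*"
proof -
  have "tree_rel G T = (steps (darts_over T))\<inverse>"
    by (auto simp: tree_rel_def steps_def darts_over_def)
  then show ?thesis
    using sym_steps[OF edge_closed_darts_over] by (simp add: conn_def sym_conv_converse_eq)
qed

lemma dual_rel_outer_iff:
  "(f, outer G) \<in> (dual_rel G C)\<^sup>* \<longleftrightarrow> f \<in> dual.reached (darts G - darts_over C)"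
proof -
  let ?B = "darts G - darts_over C"
  have "dual_rel G C = (dual.steps ?B)\<inverse>"
    by (auto simp: dual_rel_def dual.steps_def darts_over_def)
  then show ?thesis
    by (simp add: rtrancl_converse dual.reached_def outer)
qed

lemma spanning_darts_darts_over:
  assumes T: "spanning_tree G T"
  shows "spanning_darts (darts_over T)"
proof -
  have "V \<subseteq> reached (darts_over T)"
    using T d\<^sub>0_in by (auto simp: spanning_tree_def conn_iff verts_def reached_def)
  moreover have "(vert_of G d, vert_of G (alp G d)) \<notin> (steps (darts_over T - edge d))\<^sup>*" if "d \<in> darts_over T" for d
    using T that darts_over_remove[of d T] by (auto simp: spanning_tree_def conn_iff darts_over_def)
  ultimately show ?thesis
    using edge_closed_darts_over by (simp add: spanning_darts_def)
qed

lemma darts_over_fund_cycle: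
  assumes d: "d \<in> darts G"
  shows "darts_over (fund_cycle G T d) = cycle_darts (darts_over T) d"
proof -
  have "e \<in> darts_over (fund_cycle G T d) \<longleftrightarrow> e \<in> cycle_darts (darts_over T) d" if e: "e \<in> darts G" for e
  proof -
    have mem: "e \<in> darts_over S \<longleftrightarrow> edge_of G e \<in> S" for S
      using e by (simp add: darts_over_def)
    show ?thesis
      unfolding cycle_darts_def path_darts_def fund_cycle_def tree_path_edges_def
      using edge_of_eq_iff[OF d e] by (simp add: mem conn_iff darts_over_remove[OF e])
  qed
  moreover have "cycle_darts (darts_over T) d \<subseteq> darts G"
    using d by (auto simp: cycle_darts_def path_darts_def darts_over_def)
  ultimately show ?thesis
    by (auto simp: darts_over_def)
qed

lemma tree_orient_eq_matching_orientation:
  assumes T: "spanning_tree G T"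
  obtains P Q where "tree_pair P Q" "P \<union> alp G ` P = darts_over T" "tree_orient G T = matching_orientation P Q"
proof -
  define T' where "T' = darts_over T"
  have T': "spanning_darts T'"
    unfolding T'_def by (rule spanning_darts_darts_over[OF T])
  obtain P where P: "arborescence P" "P \<union> alp G ` P = T'"
    and parent: "\<And>d. d \<in> T' \<Longrightarrow> d \<in> P \<longleftrightarrow> vert_of G d \<notin> reached (T' - edge d)"
    using spanning_darts_arborescence[OF T'] by blast
  obtain Q where PQ: "tree_pair P Q" and Q: "Q \<union> alp G ` Q = darts G - T'"
    using complementary_arborescence[OF P(1)] P(2) by metis
  have "d \<in> tree_orient G T \<longleftrightarrow> d \<in> matching_orientation P Q" if d: "d \<in> darts G" for d
  proof (cases "d \<in> T'")
    case True
    then have "d \<in> tree_orient G T \<longleftrightarrow> vert_of G d \<in> reached (T' - edge d)"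
      using d darts_over_remove[OF d, of T]
      by (simp add: tree_orient_def conn_iff T'_def darts_over_def[of T] reached_def root)
    moreover have "alp G d \<notin> Q"
      using Q True edge_closedD(2)[OF spanning_dartsD(1)[OF T'] d] by blast
    ultimately show ?thesis
      using parent[OF True] mem_matching_orientation_iff(2)[OF PQ d] by blast
  next
    case False
    then have "d \<in> tree_orient G T \<longleftrightarrow> face_of G d \<notin> dual.reached (darts G - cycle_darts T' d)"
      using d by (simp add: tree_orient_def dual_rel_outer_iff darts_over_fund_cycle T'_def darts_over_def[of T])
    also have "\<dots> \<longleftrightarrow> d \<in> Q"
      using complementary_dart_iff_enclosed[OF T' _ Q] PQ d False by (simp add: tree_pair_def)
    also have "\<dots> \<longleftrightarrow> d \<in> matching_orientation P Q"
      using P(2) False edge_closedD(2)[OF spanning_dartsD(1)[OF T'] d] mem_matching_orientation_iff(1)[OF PQ d] by blast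
    finally show ?thesis .
  qed
  moreover have "tree_orient G T \<subseteq> darts G"
    by (auto simp: tree_orient_def)
  ultimately have "tree_orient G T = matching_orientation P Q"
    using matching_orientation_subset[OF PQ] by blast
  then show ?thesis
    using that PQ P(2) by (simp add: T'_def)
qed

end

section \<open>Perfect matchings of the superposition graph\<close>

definition match_set :: "'d set \<Rightarrow> 'd set \<Rightarrow> ('d \<times> hk) set" where
  "match_set P Q = (\<lambda>d. (d, Prim)) ` P \<union> (\<lambda>d. (d, Dual)) ` Q"

lemma mem_match_set_iff [simp]:
  "(d, Prim) \<in> match_set P Q \<longleftrightarrow> d \<in> P" "(d, Dual) \<in> match_set P Q \<longleftrightarrow> d \<in> Q"
  by (auto simp: match_set_def)

lemma match_set_eqI:
  assumes "\<And>d. (d, Prim) \<in> M \<longleftrightarrow> d \<in> P" "\<And>d. (d, Dual) \<in> M \<longleftrightarrow> d \<in> Q"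
  shows "M = match_set P Q"
proof (rule set_eqI)
  show "g \<in> M \<longleftrightarrow> g \<in> match_set P Q" for g
    using assms by (cases g; cases "snd g") auto
qed

lemma bij_betw_iff_ex1: "bij_betw f A B \<longleftrightarrow> f ` A \<subseteq> B \<and> (\<forall>b\<in>B. \<exists>!a. a \<in> A \<and> f a = b)"
  unfolding bij_betw_def inj_on_def by (auto simp: image_iff)

lemma ex1_match_set_black:
  "(\<exists>!g. g \<in> match_set P Q \<and> black_end G g = BV v) \<longleftrightarrow> (\<exists>!d. d \<in> P \<and> vert_of G d = v)"
  "(\<exists>!g. g \<in> match_set P Q \<and> black_end G g = BF f) \<longleftrightarrow> (\<exists>!d. d \<in> Q \<and> face_of G d = f)"
proof -
  have "g \<in> match_set P Q \<and> black_end G g = BV v \<longleftrightarrow> snd g = Prim \<and> fst g \<in> P \<and> vert_of G (fst g) = v"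
    and "g \<in> match_set P Q \<and> black_end G g = BF f \<longleftrightarrow> snd g = Dual \<and> fst g \<in> Q \<and> face_of G (fst g) = f" for g
    by (cases g; cases "snd g"; auto simp: black_end_def)+
  then show "(\<exists>!g. g \<in> match_set P Q \<and> black_end G g = BV v) \<longleftrightarrow> (\<exists>!d. d \<in> P \<and> vert_of G d = v)"
    and "(\<exists>!g. g \<in> match_set P Q \<and> black_end G g = BF f) \<longleftrightarrow> (\<exists>!d. d \<in> Q \<and> face_of G d = f)"
    unfolding Ex1_def split_paired_Ex split_paired_All by auto
qed

context rooted_plane_graph
begin

interpretation dual: planar_map "darts G" "alp G" "alp G \<circ> sig G" "face_of G" "vert_of G" d\<^sub>0
  by (rule dual_planar)

lemma plus_edges_iff [simp]:
  "(d, Prim) \<in> plus_edges G \<longleftrightarrow> d \<in> darts G \<and> vert_of G d \<noteq> root G"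
  "(d, Dual) \<in> plus_edges G \<longleftrightarrow> d \<in> darts G \<and> face_of G d \<noteq> outer G"
  by (auto simp: plus_edges_def)

lemma match_set_subset_plus_edges_iff:
  "match_set P Q \<subseteq> plus_edges G \<longleftrightarrow> P \<subseteq> darts G \<and> Q \<subseteq> darts G \<and>
    vert_of G ` P \<subseteq> V - {vert_of G d\<^sub>0} \<and> face_of G ` Q \<subseteq> F - {face_of G d\<^sub>0}"
  by (auto simp: match_set_def image_subset_iff root outer)

lemma ex1_match_set_white_iff:
  assumes "P \<subseteq> darts G" "Q \<subseteq> darts G" and d: "d \<in> darts G"
  shows "(\<exists>!g. g \<in> match_set P Q \<and> white_end G g = edge_of G d) \<longleftrightarrow>
    of_bool (d \<in> P) + of_bool (alp G d \<in> P) + of_bool (d \<in> Q) + of_bool (alp G d \<in> Q) = (1::nat)"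
proof -
  have iff: "g \<in> match_set P Q \<and> white_end G g = edge_of G d \<longleftrightarrow>
      g = (d, Prim) \<and> d \<in> P \<or> g = (alp G d, Prim) \<and> alp G d \<in> P \<or>
      g = (d, Dual) \<and> d \<in> Q \<or> g = (alp G d, Dual) \<and> alp G d \<in> Q" for g
  proof -
    obtain e k where g: "g = (e, k)" by force
    show ?thesis
      using edge_of_eq_iff[OF d, of e] subsetD[OF assms(1), of e] subsetD[OF assms(2), of e] d
      by (cases k) (auto simp: g white_end_def)
  qed
  show ?thesis
    unfolding iff using \<alpha>_neq[OF d]
    by (cases "d \<in> P"; cases "alp G d \<in> P"; cases "d \<in> Q"; cases "alp G d \<in> Q") auto
qed

lemma perfect_matching_match_set_iff: "perfect_matching G (match_set P Q) \<longleftrightarrow> dart_matching P Q"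
proof -
  have black: "(\<forall>b\<in>black_verts G. \<exists>!g. g \<in> match_set P Q \<and> black_end G g = b) \<longleftrightarrow>
      (\<forall>v\<in>V - {vert_of G d\<^sub>0}. \<exists>!d. d \<in> P \<and> vert_of G d = v) \<and>
      (\<forall>f\<in>F - {face_of G d\<^sub>0}. \<exists>!d. d \<in> Q \<and> face_of G d = f)"
    unfolding black_verts_def ball_Un ball_simps ex1_match_set_black verts_def faces_def root outer ..
  have white: "(\<forall>w\<in>white_verts G. \<exists>!g. g \<in> match_set P Q \<and> white_end G g = w) \<longleftrightarrow> edge_partition P Q"
    if "P \<subseteq> darts G" "Q \<subseteq> darts G"
    unfolding white_verts_def edges_def edge_partition_def ball_simps
    by (rule ball_cong[OF refl ex1_match_set_white_iff[OF that]])
  show ?thesis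
    unfolding perfect_matching_def dart_matching_def bij_betw_iff_ex1 match_set_subset_plus_edges_iff black
    using white by satx
qed

lemma perfect_matching_match_set_tree_pair: "perfect_matching G (match_set P Q) \<longleftrightarrow> tree_pair P Q"
  by (simp add: perfect_matching_match_set_iff dart_matching_iff_tree_pair)

lemma perfect_matchingE:
  assumes "perfect_matching G M"
  obtains P Q where "tree_pair P Q" "M = match_set P Q"
proof
  show M: "M = match_set {d. (d, Prim) \<in> M} {d. (d, Dual) \<in> M}"
    by (rule match_set_eqI) simp_all
  show "tree_pair {d. (d, Prim) \<in> M} {d. (d, Dual) \<in> M}"
    using assms M perfect_matching_match_set_tree_pair by metis
qed

lemma temperley_eq_match_set:
  assumes PQ: "tree_pair P Q" and T: "P \<union> alp G ` P = darts_over T"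
    and orient: "tree_orient G T = matching_orientation P Q"
  shows "temperley G T = match_set P Q"
proof (rule match_set_eqI)
  fix d
  have P: "arborescence P" and Q: "dual.arborescence Q" and part: "edge_partition P Q"
    using PQ by (simp_all add: tree_pair_def)
  have sub: "P \<subseteq> darts G" "Q \<subseteq> darts G"
    using arborescenceD(2)[OF P] dual.arborescenceD(2)[OF Q] .
  have over: "edge_of G d \<in> T \<longleftrightarrow> d \<in> P \<or> alp G d \<in> P" if "d \<in> darts G"
    using T mem_image_\<alpha>_iff[OF sub(1) that] that by (auto simp: darts_over_def)
  have tree: "d \<in> P \<longleftrightarrow> d \<notin> matching_orientation P Q \<and> edge_of G d \<in> T"
    and cotree: "d \<in> Q \<longleftrightarrow> d \<in> matching_orientation P Q \<and> edge_of G d \<notin> T" if "d \<in> darts G"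
    using over[OF that] mem_matching_orientation_iff[OF PQ that] edge_partitionD[OF part that] by blast+
  have "vert_of G d \<noteq> root G" if "d \<in> P"
    using parent_choiceD(3)[OF arborescenceD(1)[OF P] that] root by simp
  then have "d \<in> P \<longleftrightarrow> (d, Prim) \<in> plus_edges G \<and> d \<notin> matching_orientation P Q \<and> edge_of G d \<in> T"
    using tree sub(1) by auto
  then show "(d, Prim) \<in> temperley G T \<longleftrightarrow> d \<in> P"
    by (simp add: temperley_def is_pos_def white_end_def orient)
  have "face_of G d \<noteq> outer G" if "d \<in> Q"
    using dual.parent_choiceD(3)[OF dual.arborescenceD(1)[OF Q] that] outer by simp
  then have "d \<in> Q \<longleftrightarrow> (d, Dual) \<in> plus_edges G \<and> d \<in> matching_orientation P Q \<and> edge_of G d \<notin> T"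
    using cotree sub(2) by auto
  then show "(d, Dual) \<in> temperley G T \<longleftrightarrow> d \<in> Q"
    by (simp add: temperley_def is_pos_def white_end_def orient)
qed

lemma matched_match_set:
  assumes PQ: "tree_pair P Q" and g: "g \<in> match_set P Q" "white_end G g = edge_of G d" and d: "d \<in> darts G"
  shows "matched G (match_set P Q) (edge_of G d) = g"
proof -
  have "edge_of G d \<in> white_verts G"
    using d by (simp add: white_verts_def edges_def)
  moreover have "perfect_matching G (match_set P Q)"
    using PQ by (simp add: perfect_matching_match_set_tree_pair)
  ultimately have "\<exists>!g. g \<in> match_set P Q \<and> white_end G g = edge_of G d"
    by (simp add: perfect_matching_def)
  then show ?thesis
    unfolding matched_def using g by (blast intro: the1_equality)
qed

lemma is_pos_matched_iff:
  assumes PQ: "tree_pair P Q" and U: "orientation U" and d: "d \<in> U"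
  shows "is_pos U (matched G (match_set P Q) (edge_of G d)) \<longleftrightarrow> d \<in> matching_orientation P Q"
proof -
  have dD: "d \<in> darts G" "alp G d \<notin> U"
    using orientationD[OF U] d by auto
  note matched = matched_match_set[OF PQ _ _ dD(1)] and mem = mem_matching_orientation_iff[OF PQ dD(1)]
  have "edge_covered P Q d"
    using edge_partition_covered[OF _ dD(1)] PQ by (simp add: tree_pair_def)
  then consider "d \<in> P" | "alp G d \<in> P" | "d \<in> Q" | "alp G d \<in> Q"
    by (auto simp: edge_covered_def)
  then show ?thesis
  proof cases
    case 1
    then show ?thesis using matched[of "(d, Prim)"] mem(2) d by (simp add: white_end_def is_pos_def)
  next
    case 2
    then show ?thesis using matched[of "(alp G d, Prim)"] mem(1) dD by (simp add: white_end_def is_pos_def)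
  next
    case 3
    then show ?thesis using matched[of "(d, Dual)"] mem(1) d by (simp add: white_end_def is_pos_def)
  next
    case 4
    then show ?thesis using matched[of "(alp G d, Dual)"] mem(2) dD by (simp add: white_end_def is_pos_def)
  qed
qed

end

section \<open>The Kasteleyn cokernel\<close>

context rooted_plane_graph
begin

interpretation dual: planar_map "darts G" "alp G" "alp G \<circ> sig G" "face_of G" "vert_of G" d\<^sub>0
  by (rule dual_planar)

lemma sum_kast_row:
  "(\<Sum>b\<in>black_verts G. c b * kast_row G U b w) =
    (\<Sum>g\<in>{g \<in> plus_edges G. white_end G g = w}. c (black_end G g) * (if is_pos U g then 1 else - 1))"
proof -
  let ?A = "{g \<in> plus_edges G. white_end G g = w}"
  let ?term = "\<lambda>g. c (black_end G g) * (if is_pos U g then 1 else - 1)"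
  have "plus_edges G \<subseteq> darts G \<times> {Prim, Dual}"
    by (auto simp: plus_edges_def)
  then have "finite (plus_edges G)"
    by (rule finite_subset) (simp add: finite_D)
  moreover have "finite (black_verts G)"
    using finite_D by (simp add: black_verts_def verts_def faces_def)
  moreover have "black_end G ` ?A \<subseteq> black_verts G"
    by (auto simp: black_end_def black_verts_def plus_edges_def verts_def faces_def)
  ultimately have "(\<Sum>b\<in>black_verts G. \<Sum>g\<in>{g \<in> ?A. black_end G g = b}. ?term g) = (\<Sum>g\<in>?A. ?term g)"
    by (intro sum.group) simp_all
  moreover have "c b * kast_row G U b w = (\<Sum>g\<in>{g \<in> ?A. black_end G g = b}. ?term g)" for b
    unfolding kast_row_def sum_distrib_left by (rule sum.cong) auto
  ultimately show ?thesis by simp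
qed

lemma plus_edges_at_edge:
  assumes "d \<in> darts G"
  shows "{g \<in> plus_edges G. white_end G g = edge_of G d} =
    {g \<in> {(d, Prim), (alp G d, Prim), (d, Dual), (alp G d, Dual)}. g \<in> plus_edges G}"
proof (rule set_eqI)
  fix g :: "'d \<times> hk"
  obtain e k where "g = (e, k)" by force
  then show "g \<in> {g \<in> plus_edges G. white_end G g = edge_of G d} \<longleftrightarrow>
      g \<in> {g \<in> {(d, Prim), (alp G d, Prim), (d, Dual), (alp G d, Dual)}. g \<in> plus_edges G}"
    using edge_of_eq_iff[OF assms, of e] by (cases k) (auto simp: white_end_def)
qed

lemma sum_kast_row_eq_cob:
  assumes U: "orientation U" and d: "d \<in> U"
  shows "(\<Sum>b\<in>black_verts G. c b * kast_row G U b (edge_of G d)) =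
    cob (\<lambda>v. if v = root G then 0 else c (BV v)) d + dual.cob (\<lambda>f. if f = outer G then 0 else - c (BF f)) d"
proof -
  let ?halves = "{(d, Prim), (alp G d, Prim), (d, Dual), (alp G d, Dual)}"
  let ?term = "\<lambda>g. if g \<in> plus_edges G then c (black_end G g) * (if is_pos U g then 1 else - 1) else 0"
  have dD: "d \<in> darts G" "alp G d \<notin> U"
    using orientationD[OF U] d by auto
  have "(\<Sum>b\<in>black_verts G. c b * kast_row G U b (edge_of G d)) = sum ?term ?halves"
    unfolding sum_kast_row plus_edges_at_edge[OF dD(1)] by (rule sum.inter_filter) simp
  also have "\<dots> = ?term (d, Prim) + (?term (alp G d, Prim) + (?term (d, Dual) + ?term (alp G d, Dual)))"
    using \<alpha>_neq[OF dD(1)] by (subst sum.insert; simp)+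
  also have "?term (d, Prim) = (if vert_of G d = root G then 0 else - c (BV (vert_of G d)))"
    using dD d by (simp add: black_end_def is_pos_def)
  also have "?term (alp G d, Prim) = (if vert_of G (alp G d) = root G then 0 else c (BV (vert_of G (alp G d))))"
    using dD by (simp add: black_end_def is_pos_def)
  also have "?term (d, Dual) = (if face_of G d = outer G then 0 else c (BF (face_of G d)))"
    using dD d by (simp add: black_end_def is_pos_def)
  also have "?term (alp G d, Dual) = (if face_of G (alp G d) = outer G then 0 else - c (BF (face_of G (alp G d))))"
    using dD by (simp add: black_end_def is_pos_def)
  finally show ?thesis
    by (simp add: cob_def dual.cob_def)
qed

lemma edges_positive_dart:
  assumes U: "orientation U" and w: "w \<in> edges G"
  obtains d where "d \<in> U" "w = edge_of G d"
proof -
  obtain e where "e \<in> darts G" "w = edge_of G e"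
    using w by (auto simp: edges_def)
  then show ?thesis
    using that orientationD(2)[OF U] edge_of_alp by metis
qed

lemma Prin_iff:
  assumes U: "orientation U" and x: "x \<in> ZW G"
  shows "x \<in> Prin G U \<longleftrightarrow> (\<exists>g h. \<forall>d\<in>U. x (edge_of G d) = cob g d + dual.cob h d)"
proof
  assume "x \<in> Prin G U"
  then obtain c where "x = (\<lambda>w. \<Sum>b\<in>black_verts G. c b * kast_row G U b w)"
    by (auto simp: Prin_def)
  then show "\<exists>g h. \<forall>d\<in>U. x (edge_of G d) = cob g d + dual.cob h d"
    using sum_kast_row_eq_cob[OF U, of _ c] by blast
next
  assume "\<exists>g h. \<forall>d\<in>U. x (edge_of G d) = cob g d + dual.cob h d"
  then obtain g h where gh: "\<And>d. d \<in> U \<Longrightarrow> x (edge_of G d) = cob g d + dual.cob h d"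
    by blast
  define c where "c b = (case b of BV v \<Rightarrow> g v - g (root G) | BF f \<Rightarrow> h (outer G) - h f)" for b
  have "x w = (\<Sum>b\<in>black_verts G. c b * kast_row G U b w)" for w
  proof (cases "w \<in> edges G")
    case True
    then obtain d where d: "d \<in> U" "w = edge_of G d"
      using edges_positive_dart[OF U] by blast
    show ?thesis
      unfolding d(2) sum_kast_row_eq_cob[OF U d(1)] gh[OF d(1)] by (simp add: cob_def dual.cob_def c_def)
  next
    case False
    then have "{g \<in> plus_edges G. white_end G g = w} = {}"
      by (auto simp: plus_edges_def white_end_def edges_def)
    then have "(\<Sum>b\<in>black_verts G. c b * kast_row G U b w) = 0"
      unfolding sum_kast_row by (simp only: sum.empty)
    then show ?thesis
      using x False by (simp add: ZW_def white_verts_def)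
  qed
  then show "x \<in> Prin G U"
    unfolding Prin_def by blast
qed

text \<open>For x with entries 0 and 1 this is the indicator of U with the edges in the support of x reversed.\<close>
definition flipped :: "'d set \<Rightarrow> ('d set \<Rightarrow> int) \<Rightarrow> 'd \<Rightarrow> int" where
  "flipped U x d = (if d \<in> U then 1 - x (edge_of G d) else x (edge_of G d))"

lemma quasi_orientation_flipped: "orientation U \<Longrightarrow> quasi_orientation (flipped U x)"
  by (auto simp: quasi_orientation_def flipped_def orientation_def)

lemma krel_iff_equivalent:
  assumes U: "orientation U"
  shows "(x, y) \<in> krel G U \<longleftrightarrow> x \<in> ZW G \<and> y \<in> ZW G \<and> equivalent (flipped U x) (flipped U y)"
proof -
  have "(\<forall>d\<in>U. x (edge_of G d) - y (edge_of G d) = cob g d + dual.cob h d) \<longleftrightarrow>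
      (\<forall>d\<in>darts G. flipped U y d - flipped U x d = cob g d + dual.cob h d)" for g h
  proof
    assume onU: "\<forall>d\<in>U. x (edge_of G d) - y (edge_of G d) = cob g d + dual.cob h d"
    show "\<forall>d\<in>darts G. flipped U y d - flipped U x d = cob g d + dual.cob h d"
    proof
      fix d assume d: "d \<in> darts G"
      then have "d \<in> U \<or> alp G d \<in> U"
        using orientationD(2)[OF U] by blast
      then show "flipped U y d - flipped U x d = cob g d + dual.cob h d"
        using onU d orientationD(2)[OF U d] by (auto simp: flipped_def cob_def dual.cob_def)
    qed
  next
    assume onD: "\<forall>d\<in>darts G. flipped U y d - flipped U x d = cob g d + dual.cob h d"
    show "\<forall>d\<in>U. x (edge_of G d) - y (edge_of G d) = cob g d + dual.cob h d"
    proof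
      fix d assume d: "d \<in> U"
      then have "flipped U y d - flipped U x d = cob g d + dual.cob h d"
        using onD orientationD(1)[OF U] by blast
      then show "x (edge_of G d) - y (edge_of G d) = cob g d + dual.cob h d"
        using d by (simp add: flipped_def)
    qed
  qed
  moreover have "(\<lambda>w. x w - y w) \<in> ZW G" if "x \<in> ZW G" "y \<in> ZW G"
    using that by (simp add: ZW_def)
  ultimately show ?thesis
    using Prin_iff[OF U, of "\<lambda>w. x w - y w"] by (auto simp: krel_def equivalent_def)
qed

lemma equiv_krel:
  assumes U: "orientation U"
  shows "equiv (ZW G) (krel G U)"
proof (rule equivI)
  show "krel G U \<subseteq> ZW G \<times> ZW G"
    by (auto simp: krel_def)
  show "refl_on (ZW G) (krel G U)"
    using equivalent_refl by (auto simp: refl_on_def krel_iff_equivalent[OF U])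
  show "sym (krel G U)"
    using equivalent_sym by (auto simp: sym_def krel_iff_equivalent[OF U])
  show "trans (krel G U)"
    using equivalent_trans by (auto simp: trans_def krel_iff_equivalent[OF U])
qed

lemma psi_vec_in_ZW: "psi_vec G U M0 M \<in> ZW G"
  by (simp add: psi_vec_def ZW_def)

lemma flipped_psi_vec:
  assumes PQ0: "tree_pair P0 Q0" and PQ: "tree_pair P Q" and d: "d \<in> darts G"
  defines "U \<equiv> matching_orientation P0 Q0"
  shows "flipped U (psi_vec G U (match_set P0 Q0) (match_set P Q)) d = indicator (matching_orientation P Q) d"
proof -
  let ?psi = "psi_vec G U (match_set P0 Q0) (match_set P Q)"
  have U: "orientation U"
    unfolding U_def by (rule orientation_matching_orientation[OF PQ0])
  have psi: "?psi (edge_of G e) = of_bool (e \<notin> matching_orientation P Q)" if e: "e \<in> U" for e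
  proof -
    have "edge_of G e \<in> white_verts G"
      using orientationD(1)[OF U] e by (auto simp: white_verts_def edges_def)
    then show ?thesis
      using is_pos_matched_iff[OF PQ0 U e] is_pos_matched_iff[OF PQ U e] e
      by (auto simp: psi_vec_def U_def)
  qed
  show ?thesis
  proof (cases "d \<in> U")
    case True
    then show ?thesis
      using psi[of d] by (simp add: flipped_def indicator_def)
  next
    case False
    then have "?psi (edge_of G d) = of_bool (alp G d \<notin> matching_orientation P Q)"
      using psi[of "alp G d"] orientationD(2)[OF U d] d by simp
    then show ?thesis
      using False orientationD(2)[OF orientation_matching_orientation[OF PQ] d]
      by (simp add: flipped_def indicator_def)
  qed
qed

lemma Psi_eq_class_iff:
  assumes PQ0: "tree_pair P0 Q0" "tree_orient G T0 = matching_orientation P0 Q0" "temperley G T0 = match_set P0 Q0"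
    and PQ: "tree_pair P Q" and x: "x \<in> ZW G"
  shows "krel G (tree_orient G T0) `` {x} = Psi G T0 (match_set P Q) \<longleftrightarrow>
    equivalent (flipped (tree_orient G T0) x) (indicator (matching_orientation P Q))"
proof -
  let ?psi = "psi_vec G (tree_orient G T0) (temperley G T0) (match_set P Q)"
  have U: "orientation (tree_orient G T0)"
    using orientation_matching_orientation[OF PQ0(1)] PQ0(2) by simp
  have "krel G (tree_orient G T0) `` {x} = Psi G T0 (match_set P Q) \<longleftrightarrow>
      equivalent (flipped (tree_orient G T0) x) (flipped (tree_orient G T0) ?psi)"
    unfolding Psi_def eq_equiv_class_iff[OF equiv_krel[OF U] x psi_vec_in_ZW] krel_iff_equivalent[OF U]
    using x psi_vec_in_ZW by simp
  also have "\<dots> \<longleftrightarrow> equivalent (flipped (tree_orient G T0) x) (indicator (matching_orientation P Q))"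
    using flipped_psi_vec[OF PQ0(1) PQ] by (intro equivalent_cong) (simp_all add: PQ0(2,3))
  finally show ?thesis .
qed

lemma tree_orient_temperley:
  assumes "spanning_tree G T"
  obtains P Q where "tree_pair P Q" "tree_orient G T = matching_orientation P Q" "temperley G T = match_set P Q"
  using tree_orient_eq_matching_orientation[OF assms] temperley_eq_match_set by metis

theorem inj_on_Psi:
  assumes "spanning_tree G T0"
  shows "inj_on (Psi G T0) (perfect_matchings G)"
proof (rule inj_onI)
  obtain P0 Q0 where PQ0: "tree_pair P0 Q0" "tree_orient G T0 = matching_orientation P0 Q0"
    "temperley G T0 = match_set P0 Q0"
    by (rule tree_orient_temperley[OF assms])
  fix M M' assume M: "M \<in> perfect_matchings G" "M' \<in> perfect_matchings G" and eq: "Psi G T0 M = Psi G T0 M'"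
  obtain P Q where PQ: "tree_pair P Q" "M = match_set P Q"
    by (rule perfect_matchingE[of M]) (use M(1) in \<open>simp_all add: perfect_matchings_def\<close>)
  obtain P' Q' where PQ': "tree_pair P' Q'" "M' = match_set P' Q'"
    by (rule perfect_matchingE[of M']) (use M(2) in \<open>simp_all add: perfect_matchings_def\<close>)
  let ?x = "flipped (tree_orient G T0) (psi_vec G (tree_orient G T0) (temperley G T0) M)"
  have x: "?x d = indicator (matching_orientation P Q) d" if "d \<in> darts G" for d
    using flipped_psi_vec[OF PQ0(1) PQ(1) that] by (simp add: PQ0(2,3) PQ(2))
  have "equivalent ?x (indicator (matching_orientation P' Q'))"
    by (rule Psi_eq_class_iff[OF PQ0 PQ'(1) psi_vec_in_ZW, THEN iffD1])
      (use eq in \<open>simp add: Psi_def PQ'(2)\<close>)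
  then have "equivalent (indicator (matching_orientation P Q)) (indicator (matching_orientation P' Q'))"
    using equivalent_cong[of ?x "indicator (matching_orientation P Q)"] x by blast
  then show "M = M'"
    using matching_orientation_inj[OF PQ(1) PQ'(1)] equivalent_matching_orientations_eq[OF PQ(1) PQ'(1)] PQ(2) PQ'(2)
    by blast
qed

theorem Psi_image:
  assumes "spanning_tree G T0"
  shows "Psi G T0 ` perfect_matchings G = kcoker G (tree_orient G T0)"
proof
  show "Psi G T0 ` perfect_matchings G \<subseteq> kcoker G (tree_orient G T0)"
    unfolding Psi_def kcoker_def by (auto intro: quotientI psi_vec_in_ZW)
  obtain P0 Q0 where PQ0: "tree_pair P0 Q0" "tree_orient G T0 = matching_orientation P0 Q0"
    "temperley G T0 = match_set P0 Q0"
    by (rule tree_orient_temperley[OF assms])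
  show "kcoker G (tree_orient G T0) \<subseteq> Psi G T0 ` perfect_matchings G"
  proof
    fix X assume "X \<in> kcoker G (tree_orient G T0)"
    then obtain x where x: "x \<in> ZW G" "X = krel G (tree_orient G T0) `` {x}"
      by (auto simp: kcoker_def elim: quotientE)
    have "quasi_orientation (flipped (tree_orient G T0) x)"
      using quasi_orientation_flipped orientation_matching_orientation[OF PQ0(1)] PQ0(2) by simp
    then obtain P Q where PQ: "tree_pair P Q"
      "equivalent (flipped (tree_orient G T0) x) (indicator (matching_orientation P Q))"
      by (rule quasi_orientation_equivalent_matching_orientation)
    then have "X = Psi G T0 (match_set P Q)"
      using Psi_eq_class_iff[OF PQ0 PQ(1) x(1)] x(2) by simp
    moreover have "match_set P Q \<in> perfect_matchings G"
      using PQ(1) by (simp add: perfect_matchings_def perfect_matching_match_set_tree_pair)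
    ultimately show "X \<in> Psi G T0 ` perfect_matchings G" by blast
  qed
qed

end

theorem theorem3p2:
  fixes G :: "'d emb" and T0 :: "'d set set"
  assumes "plane_graph G" and "spanning_tree G T0"
  shows "bij_betw (Psi G T0) (perfect_matchings G) (kcoker G (tree_orient G T0)) \<and>
         Psi G T0 (temperley G T0) = krel G (tree_orient G T0) `` {\<lambda>w. 0}"
proof -
  obtain d\<^sub>0 where "rooted_plane_graph G d\<^sub>0"
    using assms(1) by (auto simp: plane_graph_def rooted_plane_graph_def)
  then interpret rooted_plane_graph G d\<^sub>0 .
  have "bij_betw (Psi G T0) (perfect_matchings G) (kcoker G (tree_orient G T0))"
    using inj_on_Psi[OF assms(2)] Psi_image[OF assms(2)] by (simp add: bij_betw_def)
  moreover have "psi_vec G (tree_orient G T0) M M = (\<lambda>w. 0)" for M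
    by (auto simp: psi_vec_def)
  ultimately show ?thesis
    by (simp add: Psi_def)
qed

end
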